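(* Let $\mathbb M=\langle M;H,R,\mathcal T\rangle$ be an alter ego of a finite algebra $\mathbf M$. Then the following are equivalent: (1) $\mathbb M$ fully dualises $\mathbf M$ at the finite level; (2) (a) every hom-minimal relation on $\mathbf M$ belongs to $\mathrm{Rel}_{\mathrm{ca}}(\mathbb M)$, and (b) $\mathbb M$ is operationally rich at each relation in $\mathrm{Rel}_{\mathrm{ca}}(\mathbb M)$; (3) (a) every hom-minimal relation on $\mathbf M$ belongs to $\mathrm{Rel}_{\mathrm{ca}}(\mathbb M)$, (b) $\mathbb M$ is operationally rich at each relation in $R\cup\{\mathrm{dom}(h)\mid h\in H\}$, and (c) $\mathbb M$ is operationally rich at each relation that is conjunct-atomic definable from the hom-minimal relations on $\mathbf M$.
   Context: All algebras are non-empty (so "subalgebra" means non-empty subalgebra). $\mathbf M=\langle M;\Sigma\rangle$ is a finite algebra and $\mathcal A:=\mathsf{ISP}(\mathbf M)$ is the class of isomorphic copies of subalgebras of arbitrary (possibly zero) powers of $\mathbf M$. Compatibility: an $n$-ary relation $r\subseteq M^n$ ($n\ge 0$) is compatible with $\mathbf M$ if it is the underlying set of a subalgebra $\mathbf r$ of $\mathbf M^n$; an $n$-ary partial operation $h$ on $M$ is compatible with $\mathbf M$ if $\mathrm{graph}(h)=\{(\vec a,h(\vec a))\mid \vec a\in\mathrm{dom}(h)\}$ is a compatible relation. An alter ego of $\mathbf M$ is $\mathbb M=\langle M;H,R,\mathcal T\rangle$ with $H$ a set of compatible partial operations (total and nullary operations allowed), $R$ a set of compatible relations and $\mathcal T$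 the discrete topology. An atomic formula in the language of $\mathbb M$ is $s=t$ (true iff both terms are defined and equal) or $\rho(t_1,\dots,t_n)$ with $\rho\in R$ (true iff all $t_i$ are defined and the tuple is in $\rho$). A conjunct-atomic formula is a finite (possibly empty) conjunction of atomic formulas. $\mathrm{Rel}_{\mathrm{ca}}(\mathbb M)$ is the set of non-empty relations (of arity $n\ge0$) on $M$ defined in $\mathbb M$ by conjunct-atomic formulas. A relation is conjunct-atomic definable from the hom-minimal relations if it is non-empty and defined by a conjunct-atomic formula in the structure on $M$ whose signature is the set of all hom-minimal relations on $\mathbf M$ (equality allowed). $\mathrm{Clo}_{\mathrm{ep}}(\mathbb M)$ is the smallest set of non-empty partial operations on $M$ containing $H$ and all projections $M^n\to M$ ($n\ge1$) and closed under composition when the composite has non-empty domain (i.e. the non-empty partial operations given by terms). A compatible relation $r$ is hom-minimal if every homomorphism $\mathbf r\to\mathbf M$ is a projection. $\mathbb M$ is operationally rich at $r$ if every compatible partial operation on $\mathbf M$ with domain $r$ has an extension in $\mathrm{Clo}_{\mathrm{ep}}(\mathbb M)$. Duality: $\mathcal Z$ is the category of Boolean structures of signature $(H,R)$: (possibly empty) compact Hausdorff totally disconnected spaces with continuous partial operations on closed domains and closed relations; morphisms are continuous maps preserving relations and the domains and graphs of partial operations. An induced substructure of $\mathbb Y$ is a subset closed under the partial operations (where defined), with subspace topology and restricted relations, domains and graphs. $\mathcal X:=\mathsf{IS_cP}^{+}(\mathbb M)$ consists of isomorphic copies of topologically closed induced substructures of powers $\mathbb M^S$, $S\neq\emptyset$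 (the empty structure is included iff $H$ has no nullary operations). $D(\mathbf A)$ is the induced substructure of $\mathbb M^A$ on $\hom_{\mathcal A}(\mathbf A,\mathbf M)$, and $E(\mathbb Z)$ is the subalgebra of $\mathbf M^Z$ on $\hom_{\mathcal Z}(\mathbb Z,\mathbb M)$; $\eta_{\mathbf A}\colon\mathbf A\to ED(\mathbf A)$ and $\varepsilon_{\mathbb X}\colon\mathbb X\to DE(\mathbb X)$ are the evaluation maps. $\mathbb M$ fully dualises $\mathbf M$ at the finite level if $\eta_{\mathbf A}$ is an isomorphism for each finite $\mathbf A\in\mathcal A$ and $\varepsilon_{\mathbb X}$ is an isomorphism for each finite $\mathbb X\in\mathcal X$. *)

theory Defs
  imports "HOL-Analysis.Analysis"
begin

section \<open>Algebras\<close>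

text \<open>A signature is a partial map from operation symbols to arities; its domain is the set of
  symbols, which may be empty.\<close>

type_synonym 'f sg = "'f \<rightharpoonup> nat"

record ('f, 'a) ualg =
  univ :: "'a set"
  oper :: "'f \<Rightarrow> 'a list \<Rightarrow> 'a"

definition tuples :: "nat \<Rightarrow> 'a set \<Rightarrow> 'a list set" where
  "tuples n A = {xs. length xs = n \<and> set xs \<subseteq> A}"

definition closed_under :: "'f sg \<Rightarrow> ('f, 'a) ualg \<Rightarrow> 'a set \<Rightarrow> bool" where
  "closed_under Sg A B \<longleftrightarrow>
     (\<forall>f n xs. Sg f = Some n \<longrightarrow> xs \<in> tuples n B \<longrightarrow> oper A f xs \<in> B)"

definition ualgebra :: "'f sg \<Rightarrow> ('f, 'a) ualg \<Rightarrow> bool" where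
  "ualgebra Sg A \<longleftrightarrow> univ A \<noteq> {} \<and> closed_under Sg A (univ A)"

definition subuniverse :: "'f sg \<Rightarrow> ('f, 'a) ualg \<Rightarrow> 'a set \<Rightarrow> bool" where
  "subuniverse Sg A B \<longleftrightarrow> B \<noteq> {} \<and> B \<subseteq> univ A \<and> closed_under Sg A B"

definition subalg :: "('f, 'a) ualg \<Rightarrow> 'a set \<Rightarrow> ('f, 'a) ualg" where
  "subalg A B = A\<lparr>univ := B\<rparr>"

definition pow_alg :: "('f, 'a) ualg \<Rightarrow> 'i set \<Rightarrow> ('f, 'i \<Rightarrow> 'a) ualg" where
  "pow_alg A S =
     \<lparr>univ = S \<rightarrow>\<^sub>E univ A,
      oper = (\<lambda>f xs. \<lambda>i\<in>S. oper A f (map (\<lambda>x. x i) xs))\<rparr>"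

text \<open>The finite power \<open>A\<^sup>n\<close> on lists of length \<open>n\<close>; it carries the relations of arity \<open>n\<close>.\<close>

definition tuple_alg :: "('f, 'a) ualg \<Rightarrow> nat \<Rightarrow> ('f, 'a list) ualg" where
  "tuple_alg A n =
     \<lparr>univ = tuples n (univ A),
      oper = (\<lambda>f xss. map (\<lambda>i. oper A f (map (\<lambda>xs. xs ! i) xss)) [0..<n])\<rparr>"

definition alg_hom :: "'f sg \<Rightarrow> ('f, 'a) ualg \<Rightarrow> ('f, 'b) ualg \<Rightarrow> ('a \<Rightarrow> 'b) set" where
  "alg_hom Sg A B =
     {\<phi> \<in> univ A \<rightarrow>\<^sub>E univ B.
        \<forall>f n xs. Sg f = Some n \<longrightarrow> xs \<in> tuples n (univ A) \<longrightarrow>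
          \<phi> (oper A f xs) = oper B f (map \<phi> xs)}"

definition alg_iso :: "'f sg \<Rightarrow> ('f, 'a) ualg \<Rightarrow> ('f, 'b) ualg \<Rightarrow> ('a \<Rightarrow> 'b) set" where
  "alg_iso Sg A B = {\<phi> \<in> alg_hom Sg A B. bij_betw \<phi> (univ A) (univ B)}"

text \<open>The type argument is the universe from which the index sets of the powers are drawn;
  the zero power (\<open>S = {}\<close>) is allowed.\<close>

definition ISP :: "'i itself \<Rightarrow> 'f sg \<Rightarrow> ('f, 'a) ualg \<Rightarrow> ('f, 'b) ualg set" where
  "ISP _ Sg M =
     {A. ualgebra Sg A \<and>
         (\<exists>(S :: 'i set) B \<phi>. subuniverse Sg (pow_alg M S) B \<and>
                             \<phi> \<in> alg_iso Sg A (subalg (pow_alg M S) B))}"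


section \<open>Compatible relations, partial operations and alter egos\<close>

text \<open>Relations are sets of lists, partial operations are partial maps on lists. The arity is
  left implicit: a compatible relation is non-empty (as is a subalgebra), and so is the domain of a
  compatible partial operation, hence the arity is determined.\<close>

type_synonym 'a lrel = "'a list set"
type_synonym 'a pop = "'a list \<rightharpoonup> 'a"

definition compatible_rel :: "'f sg \<Rightarrow> ('f, 'a) ualg \<Rightarrow> nat \<Rightarrow> 'a lrel \<Rightarrow> bool" where
  "compatible_rel Sg M n r \<longleftrightarrow> subuniverse Sg (tuple_alg M n) r"

definition pop_graph :: "'a pop \<Rightarrow> 'a lrel" where
  "pop_graph h = {xs @ [y] | xs y. h xs = Some y}"

definition compatible_pop :: "'f sg \<Rightarrow> ('f, 'a) ualg \<Rightarrow> nat \<Rightarrow> 'a pop \<Rightarrow> bool" where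
  "compatible_pop Sg M n h \<longleftrightarrow>
     dom h \<subseteq> tuples n (univ M) \<and> compatible_rel Sg M (Suc n) (pop_graph h)"

text \<open>The discrete topology of the alter ego is supplied by \<open>ego\<close> below.\<close>

definition alter_ego :: "'f sg \<Rightarrow> ('f, 'a) ualg \<Rightarrow> 'a pop set \<Rightarrow> 'a lrel set \<Rightarrow> bool" where
  "alter_ego Sg M H R \<longleftrightarrow>
     (\<forall>h\<in>H. \<exists>n. compatible_pop Sg M n h) \<and> (\<forall>r\<in>R. \<exists>n. compatible_rel Sg M n r)"

definition hom_minimal :: "'f sg \<Rightarrow> ('f, 'a) ualg \<Rightarrow> 'a lrel \<Rightarrow> bool" where
  "hom_minimal Sg M r \<longleftrightarrow>
     (\<exists>n. compatible_rel Sg M n r \<and>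
        (\<forall>\<phi> \<in> alg_hom Sg (subalg (tuple_alg M n) r) M.
           \<exists>i<n. \<forall>xs\<in>r. \<phi> xs = xs ! i))"


section \<open>Conjunct-atomic formulas\<close>

text \<open>The members of \<open>H\<close> and \<open>R\<close> serve as their own symbols.\<close>

datatype 'a pterm = Var nat | App "'a pop" "'a pterm list"

datatype 'a atomic = EqAtom "'a pterm" "'a pterm" | RelAtom "'a lrel" "'a pterm list"

primrec wf_pterm :: "'a pop set \<Rightarrow> nat \<Rightarrow> 'a pterm \<Rightarrow> bool" where
  "wf_pterm H n (Var i) \<longleftrightarrow> i < n"
| "wf_pterm H n (App h ts) \<longleftrightarrow>
     h \<in> H \<and> (\<forall>xs \<in> dom h. length xs = length ts) \<and> list_all (wf_pterm H n) ts"

fun wf_atomic :: "'a pop set \<Rightarrow> 'a lrel set \<Rightarrow> nat \<Rightarrow> 'a atomic \<Rightarrow> bool" where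
  "wf_atomic H R n (EqAtom s t) \<longleftrightarrow> wf_pterm H n s \<and> wf_pterm H n t"
| "wf_atomic H R n (RelAtom r ts) \<longleftrightarrow>
     r \<in> R \<and> (\<forall>xs \<in> r. length xs = length ts) \<and> list_all (wf_pterm H n) ts"

text \<open>\<open>None\<close> stands for ``undefined''.\<close>

primrec eval_pterm :: "'a list \<Rightarrow> 'a pterm \<Rightarrow> 'a option" where
  "eval_pterm xs (Var i) = Some (xs ! i)"
| "eval_pterm xs (App h ts) =
     (let vs = map (eval_pterm xs) ts
      in if None \<in> set vs then None else h (map the vs))"

fun holds :: "'a list \<Rightarrow> 'a atomic \<Rightarrow> bool" where
  "holds xs (EqAtom s t) \<longleftrightarrow>
     (\<exists>a. eval_pterm xs s = Some a \<and> eval_pterm xs t = Some a)"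
| "holds xs (RelAtom r ts) \<longleftrightarrow>
     (\<exists>as. map (eval_pterm xs) ts = map Some as \<and> as \<in> r)"

text \<open>A list of atomic formulas is read as their conjunction.\<close>

definition ca_defined :: "'a set \<Rightarrow> nat \<Rightarrow> 'a atomic list \<Rightarrow> 'a lrel" where
  "ca_defined A n \<Phi> = {xs \<in> tuples n A. \<forall>\<alpha> \<in> set \<Phi>. holds xs \<alpha>}"

definition Rel_ca :: "'a set \<Rightarrow> 'a pop set \<Rightarrow> 'a lrel set \<Rightarrow> 'a lrel set" where
  "Rel_ca A H R =
     {r. r \<noteq> {} \<and> (\<exists>n \<Phi>. list_all (wf_atomic H R n) \<Phi> \<and> r = ca_defined A n \<Phi>)}"

definition ca_definable_from_hom_minimal :: "'f sg \<Rightarrow> ('f, 'a) ualg \<Rightarrow> 'a lrel set" where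
  "ca_definable_from_hom_minimal Sg M = Rel_ca (univ M) {} {r. hom_minimal Sg M r}"


section \<open>The enriched partial clone and operational richness\<close>

definition proj :: "'a set \<Rightarrow> nat \<Rightarrow> nat \<Rightarrow> 'a pop" where
  "proj A n i = (\<lambda>xs. if xs \<in> tuples n A then Some (xs ! i) else None)"

text \<open>The composite of \<open>f\<close> with operations \<open>gs\<close> of arity \<open>n\<close>. If \<open>f\<close> is nullary then \<open>gs = []\<close>, and
  the composite is the corresponding constant operation of arity \<open>n\<close>.\<close>

definition pcomp :: "'a set \<Rightarrow> nat \<Rightarrow> 'a pop \<Rightarrow> 'a pop list \<Rightarrow> 'a pop" where
  "pcomp A n f gs =
     (\<lambda>xs. if xs \<in> tuples n A \<and> (\<forall>g \<in> set gs. xs \<in> dom g)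
           then f (map (\<lambda>g. the (g xs)) gs) else None)"

inductive_set Clo_ep :: "'a set \<Rightarrow> 'a pop set \<Rightarrow> 'a pop set"
  for A :: "'a set" and H :: "'a pop set" where
  base: "h \<in> H \<Longrightarrow> h \<in> Clo_ep A H"
| proj: "i < n \<Longrightarrow> proj A n i \<in> Clo_ep A H"
| comp: "\<lbrakk>f \<in> Clo_ep A H; dom f \<subseteq> tuples (length gs) A;
          \<And>g. g \<in> set gs \<Longrightarrow> g \<in> Clo_ep A H;
          \<And>g. g \<in> set gs \<Longrightarrow> dom g \<subseteq> tuples n A;
          dom (pcomp A n f gs) \<noteq> {}\<rbrakk> \<Longrightarrow> pcomp A n f gs \<in> Clo_ep A H"

definition op_rich_at ::
    "'f sg \<Rightarrow> ('f, 'a) ualg \<Rightarrow> 'a pop set \<Rightarrow> 'a lrel \<Rightarrow> bool" where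
  "op_rich_at Sg M H r \<longleftrightarrow>
     (\<forall>n h. compatible_pop Sg M n h \<and> dom h = r \<longrightarrow>
        (\<exists>g \<in> Clo_ep (univ M) H. h \<subseteq>\<^sub>m g))"


section \<open>Topological structures of signature \<open>(H, R)\<close>\<close>

text \<open>The underlying set is the topspace of \<open>topo\<close>. The fields \<open>pops\<close> and \<open>rels\<close> interpret the
  symbols in \<open>H\<close> and \<open>R\<close>, which are the operations and relations of the alter ego.\<close>

record ('a, 'x) tstr =
  topo :: "'x topology"
  pops :: "'a pop \<Rightarrow> 'x pop"
  rels :: "'a lrel \<Rightarrow> 'x lrel"

abbreviation pts :: "('a, 'x) tstr \<Rightarrow> 'x set" where
  "pts X \<equiv> topspace (topo X)"

definition wf_tstr :: "'a pop set \<Rightarrow> 'a lrel set \<Rightarrow> ('a, 'x) tstr \<Rightarrow> bool" where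
  "wf_tstr H R X \<longleftrightarrow>
     (\<forall>h\<in>H. \<forall>xs y. pops X h xs = Some y \<longrightarrow>
        set xs \<subseteq> pts X \<and> y \<in> pts X \<and> (\<forall>as \<in> dom h. length as = length xs)) \<and>
     (\<forall>r\<in>R. \<forall>xs \<in> rels X r. set xs \<subseteq> pts X \<and> (\<forall>as \<in> r. length as = length xs))"

definition ego :: "('f, 'a) ualg \<Rightarrow> ('a, 'a) tstr" where
  "ego M = \<lparr>topo = discrete_topology (univ M), pops = (\<lambda>h. h), rels = (\<lambda>r. r)\<rparr>"

text \<open>Continuous maps preserving the relations and the domains and graphs of the partial
  operations.\<close>

definition morph ::
    "'a pop set \<Rightarrow> 'a lrel set \<Rightarrow> ('a, 'x) tstr \<Rightarrow> ('a, 'y) tstr \<Rightarrow> ('x \<Rightarrow> 'y) set" where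
  "morph H R X Y =
     {\<phi> \<in> pts X \<rightarrow>\<^sub>E pts Y.
        continuous_map (topo X) (topo Y) \<phi> \<and>
        (\<forall>h\<in>H. \<forall>xs y. pops X h xs = Some y \<longrightarrow> pops Y h (map \<phi> xs) = Some (\<phi> y)) \<and>
        (\<forall>r\<in>R. \<forall>xs \<in> rels X r. map \<phi> xs \<in> rels Y r)}"

definition tstr_iso ::
    "'a pop set \<Rightarrow> 'a lrel set \<Rightarrow> ('a, 'x) tstr \<Rightarrow> ('a, 'y) tstr \<Rightarrow> ('x \<Rightarrow> 'y) set" where
  "tstr_iso H R X Y =
     {\<phi> \<in> morph H R X Y. \<exists>\<psi> \<in> morph H R Y X.
        (\<forall>x \<in> pts X. \<psi> (\<phi> x) = x) \<and> (\<forall>y \<in> pts Y. \<phi> (\<psi> y) = y)}"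

text \<open>Only used for \<open>S \<noteq> {}\<close>, where the pointwise conditions force the arities to be right.\<close>

definition pow_tstr :: "('a, 'x) tstr \<Rightarrow> 'i set \<Rightarrow> ('a, 'i \<Rightarrow> 'x) tstr" where
  "pow_tstr X S =
     \<lparr>topo = product_topology (\<lambda>_. topo X) S,
      pops = (\<lambda>h xs. if set xs \<subseteq> (S \<rightarrow>\<^sub>E pts X) \<and> (\<forall>i\<in>S. map (\<lambda>x. x i) xs \<in> dom (pops X h))
                     then Some (\<lambda>i\<in>S. the (pops X h (map (\<lambda>x. x i) xs))) else None),
      rels = (\<lambda>r. {xs. set xs \<subseteq> (S \<rightarrow>\<^sub>E pts X) \<and> (\<forall>i\<in>S. map (\<lambda>x. x i) xs \<in> rels X r)})\<rparr>"

definition pop_closed :: "'a pop set \<Rightarrow> ('a, 'x) tstr \<Rightarrow> 'x set \<Rightarrow> bool" where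
  "pop_closed H X B \<longleftrightarrow>
     B \<subseteq> pts X \<and> (\<forall>h\<in>H. \<forall>xs y. set xs \<subseteq> B \<longrightarrow> pops X h xs = Some y \<longrightarrow> y \<in> B)"

definition induced :: "('a, 'x) tstr \<Rightarrow> 'x set \<Rightarrow> ('a, 'x) tstr" where
  "induced X B =
     \<lparr>topo = subtopology (topo X) B,
      pops = (\<lambda>h xs. if set xs \<subseteq> B then pops X h xs else None),
      rels = (\<lambda>r. {xs \<in> rels X r. set xs \<subseteq> B})\<rparr>"

text \<open>Members are automatically Boolean (compact Hausdorff totally disconnected, with continuous
  partial operations on closed domains and closed relations), this being inherited from powers
  of the finite discrete structure through closed substructures and isomorphisms. The set \<open>B\<close> may be
  empty exactly when \<open>H\<close> contains no nullary operation.\<close>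

definition IScP ::
    "'i itself \<Rightarrow> ('f, 'a) ualg \<Rightarrow> 'a pop set \<Rightarrow> 'a lrel set \<Rightarrow> ('a, 'x) tstr set" where
  "IScP _ M H R =
     {X. wf_tstr H R X \<and>
         (\<exists>(S :: 'i set) B \<phi>. S \<noteq> {} \<and> pop_closed H (pow_tstr (ego M) S) B \<and>
            closedin (topo (pow_tstr (ego M) S)) B \<and>
            \<phi> \<in> tstr_iso H R X (induced (pow_tstr (ego M) S) B))}"


section \<open>Full duality at the finite level\<close>

definition dual_D :: "'f sg \<Rightarrow> ('f, 'a) ualg \<Rightarrow> ('f, 'b) ualg \<Rightarrow> ('a, 'b \<Rightarrow> 'a) tstr" where
  "dual_D Sg M A = induced (pow_tstr (ego M) (univ A)) (alg_hom Sg A M)"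

definition dual_E ::
    "('f, 'a) ualg \<Rightarrow> 'a pop set \<Rightarrow> 'a lrel set \<Rightarrow> ('a, 'x) tstr \<Rightarrow> ('f, 'x \<Rightarrow> 'a) ualg" where
  "dual_E M H R X = subalg (pow_alg M (pts X)) (morph H R X (ego M))"

definition eta :: "'f sg \<Rightarrow> ('f, 'a) ualg \<Rightarrow> ('f, 'b) ualg \<Rightarrow> 'b \<Rightarrow> ('b \<Rightarrow> 'a) \<Rightarrow> 'a" where
  "eta Sg M A = (\<lambda>a \<in> univ A. \<lambda>x \<in> alg_hom Sg A M. x a)"

definition eps ::
    "('f, 'a) ualg \<Rightarrow> 'a pop set \<Rightarrow> 'a lrel set \<Rightarrow> ('a, 'x) tstr \<Rightarrow> 'x \<Rightarrow> ('x \<Rightarrow> 'a) \<Rightarrow> 'a" where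
  "eps M H R X = (\<lambda>x \<in> pts X. \<lambda>\<alpha> \<in> morph H R X (ego M). \<alpha> x)"

text \<open>The type \<open>'u\<close> is the universe over which algebras, structures and index sets range. Every
  finite algebra and structure has an isomorphic copy in it as soon as \<open>'u\<close> is infinite.\<close>

definition fully_dualises_finite_level ::
    "'u itself \<Rightarrow> 'f sg \<Rightarrow> ('f, 'a) ualg \<Rightarrow> 'a pop set \<Rightarrow> 'a lrel set \<Rightarrow> bool" where
  "fully_dualises_finite_level _ Sg M H R \<longleftrightarrow>
     (\<forall>A :: ('f, 'u) ualg. A \<in> ISP TYPE('u) Sg M \<and> finite (univ A) \<longrightarrow>
        eta Sg M A \<in> alg_iso Sg A (dual_E M H R (dual_D Sg M A))) \<and>
     (\<forall>X :: ('a, 'u) tstr. X \<in> IScP TYPE('u) M H R \<and> finite (pts X) \<longrightarrow>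
        eps M H R X \<in> tstr_iso H R X (dual_D Sg M (dual_E M H R X)))"

end

theory Submission
  imports Defs
begin

text \<open>The duality (\<open>\<eta>\<close> is an isomorphism) is condition (a) alone: listing all homomorphisms from
  \<open>A\<close> to \<open>M\<close> represents \<open>A\<close> as a hom-minimal relation, and a morphism from \<open>D(A)\<close> to the alter ego is
  precisely a tuple that satisfies every conjunct-atomic formula valid on this relation.

  For a finite \<open>X\<close> with points \<open>x\<^sub>1, \<dots>, x\<^sub>n\<close>, the algebra \<open>E(X)\<close> is the relation \<open>r\<close> of all tuples
  \<open>(u x\<^sub>1, \<dots>, u x\<^sub>n)\<close> with \<open>u\<close> a morphism. If the alter ego is operationally rich at \<open>r\<close>, then a
  homomorphism from \<open>E(X)\<close> to \<open>M\<close> is given by a term \<open>t\<close>, and is thus evaluation at the point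
  \<open>t(x\<^sub>1, \<dots>, x\<^sub>n)\<close> of \<open>X\<close>. Richness at \<open>R\<close> and at the domains of \<open>H\<close> makes \<open>r\<close> conjunct-atomic
  definable from the hom-minimal relations. Conversely, every \<open>r\<close> in \<open>Rel\<^sub>c\<^sub>a\<close> arises in this way from
  the structure of all term functions on \<open>r\<close>, and fullness there says that homomorphisms on \<open>r\<close>
  are term functions.\<close>

section \<open>Terms and conjunct-atomic definability\<close>

text \<open>The obstacle is partiality: in a power of the alter ego a term has a value only if it is
  defined in every coordinate. A substructure closed under the partial operations then contains this
  value, and every morphism into the alter ego respects it. Hence an atomic formula valid in all
  coordinates is valid under every morphism (\<open>holds_in_structure\<close>); both the
  surjectivity of \<eta> and the richness of relations in \<open>Rel_ca\<close> rest on this.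
  Conversely, every instance of a partial operation or of a relation in D(A) is itself an atom valid
  on the relation that represents A, so a tuple satisfying all valid atoms is a morphism. Since M is
  finite, one refuting atom per tuple outside a relation leaves a finite conjunction. Members of
  \<open>R\<close> and domains of members of \<open>H\<close> need not be hom-minimal. Listing the
  values of all homomorphisms on such a relation gives a hom-minimal one, and nothing is lost: the
  homomorphisms include the projections, which recover the tuple, and any partial operation with
  this domain, which gives its value. Richness is what realises the listed values as points of
  X.\<close>

primrec subst_pterm :: "'a pterm list \<Rightarrow> 'a pterm \<Rightarrow> 'a pterm" where
  "subst_pterm ts (Var i) = ts ! i"
| "subst_pterm ts (App h us) = App h (map (subst_pterm ts) us)"

fun subst_atomic :: "'a pterm list \<Rightarrow> 'a atomic \<Rightarrow> 'a atomic" where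
  "subst_atomic ts (EqAtom s t) = EqAtom (subst_pterm ts s) (subst_pterm ts t)"
| "subst_atomic ts (RelAtom r us) = RelAtom r (map (subst_pterm ts) us)"

lemma wf_subst_pterm:
  "wf_pterm H (length ts) t \<Longrightarrow> list_all (wf_pterm H n) ts \<Longrightarrow> wf_pterm H n (subst_pterm ts t)"
  by (induction t) (auto simp: list_all_length list_all_iff)

lemma wf_subst_atomic:
  "wf_atomic H R (length ts) \<alpha> \<Longrightarrow> list_all (wf_pterm H n) ts \<Longrightarrow>
    wf_atomic H R n (subst_atomic ts \<alpha>)"
  by (cases \<alpha>) (auto intro: wf_subst_pterm simp: list_all_iff)

lemma eval_subst_pterm:
  assumes "wf_pterm H (length ts) t" "map (eval_pterm xs) ts = map Some vs"
  shows "eval_pterm xs (subst_pterm ts t) = eval_pterm vs t"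
  using assms(1)
proof (induction t)
  case (Var i)
  then have "i < length ts" "length ts = length vs"
    using assms(2) by (auto dest: map_eq_imp_length_eq)
  then show ?case
    using arg_cong[OF assms(2), of "\<lambda>l. l ! i"] by simp
next
  case (App h us)
  then have *: "map (eval_pterm xs) (map (subst_pterm ts) us) = map (eval_pterm vs) us"
    by (auto simp: list_all_iff)
  show ?case
    by (simp only: subst_pterm.simps eval_pterm.simps *)
qed

lemma holds_subst_atomic:
  assumes "wf_atomic H R (length ts) \<alpha>" "map (eval_pterm xs) ts = map Some vs"
  shows "holds xs (subst_atomic ts \<alpha>) \<longleftrightarrow> holds vs \<alpha>"
proof (cases \<alpha>)
  case (EqAtom s t)
  then show ?thesis
    using assms(1) by (simp add: eval_subst_pterm[where H = H, OF _ assms(2)])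
next
  case (RelAtom r us)
  then have "map (eval_pterm xs) (map (subst_pterm ts) us) = map (eval_pterm vs) us"
    using assms by (auto simp: list_all_iff intro!: eval_subst_pterm)
  then show ?thesis
    by (simp only: RelAtom subst_atomic.simps holds.simps)
qed

lemma None_in_map_iff: "None \<notin> set xs \<longleftrightarrow> (\<exists>ys. xs = map Some ys)"
  by (induction xs) (auto simp: Cons_eq_map_conv, metis option.exhaust)

lemma eval_App_eq_Some:
  "eval_pterm xs (App h ts) = Some y \<longleftrightarrow>
    (\<exists>vs. map (eval_pterm xs) ts = map Some vs \<and> h vs = Some y)"
proof -
  have "eval_pterm xs (App h ts) = Some y \<longleftrightarrow>
      None \<notin> set (map (eval_pterm xs) ts) \<and> h (map the (map (eval_pterm xs) ts)) = Some y"
    unfolding eval_pterm.simps Let_def by (simp del: set_map map_map)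
  also have "\<dots> \<longleftrightarrow> (\<exists>vs. map (eval_pterm xs) ts = map Some vs \<and> h vs = Some y)"
    unfolding None_in_map_iff by (auto simp: comp_def simp del: map_map) (auto simp: comp_def)
  finally show ?thesis .
qed

lemma eval_App_args_defined:
  "eval_pterm xs (App h ts) \<noteq> None \<Longrightarrow> t \<in> set ts \<Longrightarrow> eval_pterm xs t \<noteq> None"
  by (auto simp: Let_def image_iff split: if_splits) (metis not_None_eq)

lemma eval_App_map_Var: "eval_pterm xs (App h (map Var is)) = h (map ((!) xs) is)"
  by (auto simp: Let_def comp_def)

lemma holds_RelAtom_map_Var: "holds xs (RelAtom r (map Var is)) \<longleftrightarrow> map ((!) xs) is \<in> r"
proof -
  have "map (eval_pterm xs) (map Var is) = map Some (map ((!) xs) is)"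
    by simp
  then show ?thesis
    unfolding holds.simps by (metis list.inj_map_strong option.inject)
qed

lemma map_nth_upt: "length xs = n \<Longrightarrow> map ((!) xs) [0..<n] = xs"
  by (metis map_nth)

lemma ex_map_of_list_all:
  assumes "\<And>x. x \<in> set xs \<Longrightarrow> \<exists>y. P x y"
  shows "\<exists>ys. length ys = length xs \<and> (\<forall>i<length xs. P (xs ! i) (ys ! i))"
proof -
  obtain f where "\<And>x. x \<in> set xs \<Longrightarrow> P x (f x)"
    using assms by metis
  then show ?thesis
    by (intro exI[of _ "map f xs"]) auto
qed

section \<open>Conjunct-atomic definability over a finite set\<close>

lemma finite_tuples: "finite A \<Longrightarrow> finite (tuples n A)"
  using finite_lists_length_eq[of A n] unfolding tuples_def by (simp add: conj_commute)

text \<open>Only finitely many tuples lie outside \<open>r\<close>, so one refuting atom for each of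
  them gives a finite conjunction. The main definability results use this criterion and thus treat a
  single tuple \<open>v\<close> at a time.\<close>

lemma ca_definedI:
  assumes "finite A" "r \<subseteq> tuples n A"
    and sep: "\<And>v. v \<in> tuples n A \<Longrightarrow> v \<notin> r \<Longrightarrow>
      \<exists>\<alpha>. wf_atomic H R n \<alpha> \<and> (\<forall>xs\<in>r. holds xs \<alpha>) \<and> \<not> holds v \<alpha>"
  shows "\<exists>\<Phi>. list_all (wf_atomic H R n) \<Phi> \<and> r = ca_defined A n \<Phi>"
proof -
  obtain F where F: "\<And>v. v \<in> tuples n A - r \<Longrightarrow>
      wf_atomic H R n (F v) \<and> (\<forall>xs\<in>r. holds xs (F v)) \<and> \<not> holds v (F v)"
    using sep by (metis DiffE)
  have "finite (F ` (tuples n A - r))"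
    using assms(1) by (simp add: finite_tuples)
  then obtain \<Phi> where \<Phi>: "set \<Phi> = F ` (tuples n A - r)"
    using finite_list by blast
  have "r = ca_defined A n \<Phi>"
    unfolding ca_defined_def \<Phi> using assms(2) F by blast
  moreover have "list_all (wf_atomic H R n) \<Phi>"
    unfolding list_all_iff \<Phi> using F by blast
  ultimately show ?thesis
    by blast
qed

lemma mem_Rel_caI:
  assumes "r \<in> R" "r \<noteq> {}" "r \<subseteq> tuples n A"
  shows "r \<in> Rel_ca A H R"
proof -
  have "list_all (wf_atomic H R n) [RelAtom r (map Var [0..<n])]"
    using assms by (auto simp: list_all_iff tuples_def)
  moreover have "r = ca_defined A n [RelAtom r (map Var [0..<n])]"
    using assms(3) unfolding ca_defined_def
    by (auto simp: holds_RelAtom_map_Var tuples_def map_nth_upt simp del: holds.simps)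
  ultimately show ?thesis
    using assms(2) unfolding Rel_ca_def by blast
qed

text \<open>An equation is true only where both sides are defined, so equating the term
  \<open>h(x1,...,xn)\<close> with itself expresses membership in the domain.\<close>

lemma dom_mem_Rel_caI:
  assumes "h \<in> H" "dom h \<noteq> {}" "dom h \<subseteq> tuples n A"
  shows "dom h \<in> Rel_ca A H R"
proof -
  let ?t = "App h (map Var [0..<n]) :: 'a pterm"
  have "list_all (wf_atomic H R n) [EqAtom ?t ?t]"
    using assms by (auto simp: list_all_iff tuples_def)
  moreover have "dom h = ca_defined A n [EqAtom ?t ?t]"
  proof -
    have "xs \<in> dom h \<longleftrightarrow> holds xs (EqAtom ?t ?t)" if "xs \<in> tuples n A" for xs
      using that by (auto simp: eval_App_map_Var tuples_def map_nth_upt simp del: eval_pterm.simps)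
    then show ?thesis
      using assms(3) unfolding ca_defined_def by (auto simp del: holds.simps)
  qed
  ultimately show ?thesis
    using assms(2) unfolding Rel_ca_def by blast
qed

text \<open>Without operation symbols the arguments of an atom are variables. A refuted atom over
  \<open>r\<close> is therefore traded for a refuted conjunct of the definition of \<open>r\<close>,
  with variables renamed along \<open>js\<close>. In the presence of (a) this derives (3)(c) from
  (2)(b).\<close>

lemma Rel_ca_mono_of_relations:
  assumes "finite A" and RR': "R \<subseteq> Rel_ca A H R'"
  shows "Rel_ca A {} R \<subseteq> Rel_ca A H R'"
proof
  fix s assume "s \<in> Rel_ca A {} R"
  then obtain n \<Phi> where s: "s \<noteq> {}" "list_all (wf_atomic {} R n) \<Phi>" "s = ca_defined A n \<Phi>"
    unfolding Rel_ca_def by auto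
  have "\<exists>\<alpha>. wf_atomic H R' n \<alpha> \<and> (\<forall>xs\<in>s. holds xs \<alpha>) \<and> \<not> holds v \<alpha>"
    if v: "v \<in> tuples n A" "v \<notin> s" for v
  proof -
    obtain \<alpha> where \<alpha>: "\<alpha> \<in> set \<Phi>" "\<not> holds v \<alpha>"
      using v s(3) unfolding ca_defined_def by auto
    have wf: "wf_atomic {} R n \<alpha>" and on_s: "\<forall>xs\<in>s. holds xs \<alpha>"
      using \<alpha>(1) s unfolding ca_defined_def by (auto simp: list_all_iff)
    have Var_only: "\<exists>i. t = Var i \<and> i < n" if "wf_pterm {} n t" for t
      using that by (cases t) auto
    show ?thesis
    proof (cases \<alpha>)
      case (EqAtom t u)
      then obtain i j where ij: "t = Var i" "u = Var j" "i < n" "j < n"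
        using wf Var_only by (metis wf_atomic.simps(1))
      then show ?thesis
        using \<alpha>(2) on_s EqAtom by (intro exI[of _ \<alpha>]) simp
    next
      case (RelAtom r us)
      have "\<exists>i. t = Var i \<and> i < n" if "t \<in> set us" for t
        using wf RelAtom that Var_only by (auto simp: list_all_iff)
      then obtain js where js: "length js = length us" "\<And>k. k < length us \<Longrightarrow> us ! k = Var (js ! k) \<and> js ! k < n"
        using ex_map_of_list_all[of us "\<lambda>t i. t = Var i \<and> i < n"] by blast
      then have us: "us = map Var js"
        by (auto intro: nth_equalityI)
      have js_n: "set js \<subseteq> {..<n}"
        using js by (auto simp: in_set_conv_nth)
      have "r \<in> R" and len: "\<And>xs. xs \<in> r \<Longrightarrow> length xs = length js"
        using wf RelAtom us by auto
      have "r \<in> Rel_ca A H R'"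
        using \<open>r \<in> R\<close> RR' by blast
      then obtain k \<Psi> where r: "r \<noteq> {}" "list_all (wf_atomic H R' k) \<Psi>" "r = ca_defined A k \<Psi>"
        unfolding Rel_ca_def by blast
      obtain xs where "xs \<in> r"
        using r(1) by blast
      then have k: "k = length js"
        using len[of xs] r(3) by (simp add: ca_defined_def tuples_def)
      have "map ((!) v) js \<notin> r"
        using \<alpha>(2) RelAtom us holds_RelAtom_map_Var by metis
      moreover have "map ((!) v) js \<in> tuples k A"
        using v(1) js_n k unfolding tuples_def by fastforce
      ultimately obtain \<beta> where \<beta>: "\<beta> \<in> set \<Psi>" "\<not> holds (map ((!) v) js) \<beta>"
        using r(3) unfolding ca_defined_def by auto
      have wf\<beta>: "wf_atomic H R' (length (map Var js :: 'a pterm list)) \<beta>"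
        using \<beta> r(2) k by (auto simp: list_all_iff)
      have sub: "holds xs (subst_atomic (map Var js) \<beta>) \<longleftrightarrow> holds (map ((!) xs) js) \<beta>" for xs
        by (rule holds_subst_atomic[OF wf\<beta>]) simp
      have "wf_atomic H R' n (subst_atomic (map Var js) \<beta>)"
        using js_n by (intro wf_subst_atomic[OF wf\<beta>]) (auto simp: list_all_iff)
      moreover have "holds xs (subst_atomic (map Var js) \<beta>)" if "xs \<in> s" for xs
      proof -
        have "map ((!) xs) js \<in> r"
          using on_s that RelAtom us holds_RelAtom_map_Var by metis
        then show ?thesis
          using \<beta>(1) r(3) unfolding sub ca_defined_def by auto
      qed
      ultimately show ?thesis
        using \<beta>(2) sub by blast
    qed
  qed
  moreover have "s \<subseteq> tuples n A"
    using s(3) unfolding ca_defined_def by auto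
  ultimately have "\<exists>\<Psi>. list_all (wf_atomic H R' n) \<Psi> \<and> s = ca_defined A n \<Psi>"
    using ca_definedI[OF assms(1)] by blast
  then show "s \<in> Rel_ca A H R'"
    using s(1) unfolding Rel_ca_def by blast
qed

section \<open>Compatible relations and operational richness\<close>

lemma mem_tuples_iff: "xs \<in> tuples n A \<longleftrightarrow> length xs = n \<and> set xs \<subseteq> A"
  by (simp add: tuples_def)

lemma tuples_arity_unique: "r \<noteq> {} \<Longrightarrow> r \<subseteq> tuples m A \<Longrightarrow> r \<subseteq> tuples n A \<Longrightarrow> m = n"
  unfolding tuples_def by blast

lemma nth_oper_tuple_alg:
  "i < n \<Longrightarrow> oper (tuple_alg A n) f xss ! i = oper A f (map (\<lambda>xs. xs ! i) xss)"
  by (simp add: tuple_alg_def)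

lemma length_oper_tuple_alg [simp]: "length (oper (tuple_alg A n) f xss) = n"
  by (simp add: tuple_alg_def)

lemma univ_tuple_alg [simp]: "univ (tuple_alg A n) = tuples n (univ A)"
  by (simp add: tuple_alg_def)

lemma univ_subalg [simp]: "univ (subalg A B) = B"
  by (simp add: subalg_def)

lemma oper_subalg [simp]: "oper (subalg A B) = oper A"
  by (simp add: subalg_def)

lemma compatible_relD:
  assumes "compatible_rel Sg M n r"
  shows "r \<noteq> {}" "r \<subseteq> tuples n (univ M)"
    "\<And>f k xss. Sg f = Some k \<Longrightarrow> length xss = k \<Longrightarrow> set xss \<subseteq> r \<Longrightarrow> oper (tuple_alg M n) f xss \<in> r"
  using assms unfolding compatible_rel_def subuniverse_def closed_under_def
  by (simp_all add: tuples_def[of _ r])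

lemma compatible_relI:
  assumes "r \<noteq> {}" "r \<subseteq> tuples n (univ M)"
    "\<And>f k xss. Sg f = Some k \<Longrightarrow> length xss = k \<Longrightarrow> set xss \<subseteq> r \<Longrightarrow> oper (tuple_alg M n) f xss \<in> r"
  shows "compatible_rel Sg M n r"
  using assms unfolding compatible_rel_def subuniverse_def closed_under_def
  by (simp add: tuples_def[of _ r])

text \<open>The last claim is closure of the graph under \<open>f\<close>: on the extended tuples
  \<open>xs @ [h xs]\<close> the operation acts separately on the first \<open>n\<close> entries and
  on the appended value.\<close>

lemma compatible_popD:
  assumes "compatible_pop Sg M n h"
  shows "dom h \<noteq> {}" "dom h \<subseteq> tuples n (univ M)" "h xs = Some y \<Longrightarrow> y \<in> univ M"
    "Sg f = Some k \<Longrightarrow> length xss = k \<Longrightarrow> set xss \<subseteq> dom h \<Longrightarrow>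
      h (oper (tuple_alg M n) f xss) = Some (oper M f (map (\<lambda>xs. the (h xs)) xss))"
proof -
  have c: "compatible_rel Sg M (Suc n) (pop_graph h)" and d: "dom h \<subseteq> tuples n (univ M)"
    using assms unfolding compatible_pop_def by auto
  show "dom h \<subseteq> tuples n (univ M)"
    by (rule d)
  show "dom h \<noteq> {}"
    using compatible_relD(1)[OF c] unfolding pop_graph_def by auto
  show "y \<in> univ M" if "h xs = Some y"
  proof -
    have "xs @ [y] \<in> pop_graph h"
      using that unfolding pop_graph_def by auto
    then show ?thesis
      using compatible_relD(2)[OF c] unfolding tuples_def by auto
  qed
  show "h (oper (tuple_alg M n) f xss) = Some (oper M f (map (\<lambda>xs. the (h xs)) xss))"
    if "Sg f = Some k" "length xss = k" "set xss \<subseteq> dom h"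
  proof -
    let ?g = "\<lambda>xs. xs @ [the (h xs)]"
    have len: "length xs = n" if "xs \<in> set xss" for xs
      using d that \<open>set xss \<subseteq> dom h\<close> mem_tuples_iff by blast
    have "oper (tuple_alg M (Suc n)) f (map ?g xss) \<in> pop_graph h"
      using that by (intro compatible_relD(3)[OF c]) (auto simp: pop_graph_def)
    moreover have "oper (tuple_alg M (Suc n)) f (map ?g xss) =
        oper (tuple_alg M n) f xss @ [oper M f (map (\<lambda>xs. the (h xs)) xss)]"
    proof (rule nth_equalityI)
      fix i assume "i < length (oper (tuple_alg M (Suc n)) f (map ?g xss))"
      then consider "i < n" | "i = n"
        by fastforce
      then show "oper (tuple_alg M (Suc n)) f (map ?g xss) ! i =
          (oper (tuple_alg M n) f xss @ [oper M f (map (\<lambda>xs. the (h xs)) xss)]) ! i"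
      proof cases
        case 1
        then have "map (\<lambda>xs. xs ! i) (map ?g xss) = map (\<lambda>xs. xs ! i) xss"
          by (auto simp: nth_append len)
        then show ?thesis
          using 1 by (simp only: nth_append nth_oper_tuple_alg less_SucI length_oper_tuple_alg if_True)
      next
        case 2
        then have "map (\<lambda>xs. xs ! i) (map ?g xss) = map (\<lambda>xs. the (h xs)) xss"
          by (auto simp: nth_append len)
        then show ?thesis
          using 2 by (simp add: nth_append nth_oper_tuple_alg del: map_map map_eq_conv)
      qed
    qed simp
    ultimately show ?thesis
      unfolding pop_graph_def by auto
  qed
qed

lemma compatible_popI:
  assumes ne: "dom h \<noteq> {}" and d: "dom h \<subseteq> tuples n (univ M)"
    and ran: "\<And>xs y. h xs = Some y \<Longrightarrow> y \<in> univ M"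
    and op: "\<And>f k xss. Sg f = Some k \<Longrightarrow> length xss = k \<Longrightarrow> set xss \<subseteq> dom h \<Longrightarrow>
      h (oper (tuple_alg M n) f xss) = Some (oper M f (map (\<lambda>xs. the (h xs)) xss))"
  shows "compatible_pop Sg M n h"
  unfolding compatible_pop_def
proof (intro conjI d compatible_relI)
  show "pop_graph h \<noteq> {}"
    using ne unfolding pop_graph_def by auto
  show "pop_graph h \<subseteq> tuples (Suc n) (univ M)"
    using d ran unfolding pop_graph_def tuples_def by fastforce
  fix f k xss
  assume *: "Sg f = Some k" "length xss = k" "set xss \<subseteq> pop_graph h"
  \<comment> \<open>A member of the graph is taken apart into argument tuple and value, to be
    recombined after \<open>f\<close> has been applied to each.\<close>
  have split: "butlast xs \<in> dom h \<and> length xs = Suc n \<and> the (h (butlast xs)) = last xs"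
    if xs: "xs \<in> set xss" for xs
  proof -
    obtain ys y where "xs = ys @ [y]" "h ys = Some y"
      using *(3) xs unfolding pop_graph_def by blast
    moreover from this have "length ys = n"
      using d mem_tuples_iff by blast
    ultimately show ?thesis
      by auto
  qed
  have "set (map butlast xss) \<subseteq> dom h"
    using split by auto
  then have "h (oper (tuple_alg M n) f (map butlast xss)) =
      Some (oper M f (map (\<lambda>xs. the (h xs)) (map butlast xss)))"
    using * by (intro op) simp_all
  moreover have "map (\<lambda>xs. the (h xs)) (map butlast xss) = map last xss"
    using split by simp
  moreover have "oper (tuple_alg M (Suc n)) f xss =
      oper (tuple_alg M n) f (map butlast xss) @ [oper M f (map last xss)]"
  proof (rule nth_equalityI)
    fix i assume "i < length (oper (tuple_alg M (Suc n)) f xss)"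
    then consider "i < n" | "i = n"
      by fastforce
    then show "oper (tuple_alg M (Suc n)) f xss ! i =
        (oper (tuple_alg M n) f (map butlast xss) @ [oper M f (map last xss)]) ! i"
    proof cases
      case 1
      then have "map (\<lambda>xs. xs ! i) (map butlast xss) = map (\<lambda>xs. xs ! i) xss"
        using split by (auto simp: nth_butlast)
      then show ?thesis
        using 1 by (simp only: nth_append nth_oper_tuple_alg less_SucI length_oper_tuple_alg if_True)
    next
      case 2
      then have "map (\<lambda>xs. xs ! i) xss = map last xss"
        using split by (intro map_cong refl) (metis Zero_not_Suc diff_Suc_1 last_conv_nth list.size(3))
      then show ?thesis
        using 2 by (simp add: nth_append nth_oper_tuple_alg del: map_map map_eq_conv)
    qed
  qed simp
  ultimately show "oper (tuple_alg M (Suc n)) f xss \<in> pop_graph h"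
    unfolding pop_graph_def by (auto simp del: map_map map_eq_conv)
qed

section \<open>Homomorphisms on a relation as compatible partial operations\<close>

lemma alg_homD:
  assumes "\<phi> \<in> alg_hom Sg A B"
  shows "\<And>a. a \<in> univ A \<Longrightarrow> \<phi> a \<in> univ B" "\<phi> \<in> extensional (univ A)"
    "\<And>f k as. Sg f = Some k \<Longrightarrow> length as = k \<Longrightarrow> set as \<subseteq> univ A \<Longrightarrow>
      \<phi> (oper A f as) = oper B f (map \<phi> as)"
  using assms unfolding alg_hom_def tuples_def by (auto simp: PiE_def)

lemma alg_homI:
  assumes "\<And>a. a \<in> univ A \<Longrightarrow> \<phi> a \<in> univ B" "\<phi> \<in> extensional (univ A)"
    "\<And>f k as. Sg f = Some k \<Longrightarrow> length as = k \<Longrightarrow> set as \<subseteq> univ A \<Longrightarrow>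
      \<phi> (oper A f as) = oper B f (map \<phi> as)"
  shows "\<phi> \<in> alg_hom Sg A B"
  using assms unfolding alg_hom_def tuples_def by (auto simp: PiE_def)

text \<open>With \<open>alg_hom_of_compatible_pop\<close> this translates between homomorphisms from
  \<open>r\<close> to \<open>M\<close>, which appear in the duality, and compatible partial
  operations with domain \<open>r\<close>, about which richness speaks.\<close>

lemma compatible_pop_of_alg_hom:
  assumes r: "compatible_rel Sg M n r" and \<phi>: "\<phi> \<in> alg_hom Sg (subalg (tuple_alg M n) r) M"
  shows "compatible_pop Sg M n (\<lambda>xs. if xs \<in> r then Some (\<phi> xs) else None)"
    (is "compatible_pop _ _ _ ?h")
proof (rule compatible_popI)
  have d: "dom ?h = r"
    by (auto split: if_splits)
  show "dom ?h \<noteq> {}" "dom ?h \<subseteq> tuples n (univ M)"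
    unfolding d using compatible_relD[OF r] by auto
  show "y \<in> univ M" if "?h xs = Some y" for xs y
    using that alg_homD(1)[OF \<phi>] by (auto split: if_splits)
  fix f k xss assume *: "Sg f = Some k" "length xss = k" "set xss \<subseteq> dom ?h"
  then have xss: "set xss \<subseteq> r"
    unfolding d by simp
  then have "map (\<lambda>xs. the (?h xs)) xss = map \<phi> xss"
    by auto
  then show "?h (oper (tuple_alg M n) f xss) = Some (oper M f (map (\<lambda>xs. the (?h xs)) xss))"
    using alg_homD(3)[OF \<phi> *(1,2)] compatible_relD(3)[OF r *(1,2)] xss by (simp del: map_eq_conv)
qed

lemma compatible_rel_dom:
  assumes "compatible_pop Sg M n h"
  shows "compatible_rel Sg M n (dom h)"
  using compatible_popD[OF assms] by (intro compatible_relI) blast+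

lemma alg_hom_of_compatible_pop:
  assumes "compatible_pop Sg M n h"
  shows "(\<lambda>xs\<in>dom h. the (h xs)) \<in> alg_hom Sg (subalg (tuple_alg M n) (dom h)) M"
proof (rule alg_homI)
  let ?A = "subalg (tuple_alg M n) (dom h)"
  show "(\<lambda>xs\<in>dom h. the (h xs)) a \<in> univ M" if "a \<in> univ ?A" for a
    using that compatible_popD(3)[OF assms] by auto
  show "(\<lambda>xs\<in>dom h. the (h xs)) \<in> extensional (univ ?A)"
    by simp
  fix f k as assume *: "Sg f = Some k" "length as = k" "set as \<subseteq> univ ?A"
  then have "h (oper (tuple_alg M n) f as) = Some (oper M f (map (\<lambda>xs. the (h xs)) as))"
    using compatible_popD(4)[OF assms] by simp
  moreover have "map (\<lambda>xs\<in>dom h. the (h xs)) as = map (\<lambda>xs. the (h xs)) as"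
    using * by auto
  ultimately show "(\<lambda>xs\<in>dom h. the (h xs)) (oper ?A f as) = oper M f (map (\<lambda>xs\<in>dom h. the (h xs)) as)"
    by (simp add: domIff del: map_eq_conv)
qed

lemma projection_in_alg_hom:
  assumes r: "compatible_rel Sg M n r" and "i < n"
  shows "(\<lambda>xs\<in>r. xs ! i) \<in> alg_hom Sg (subalg (tuple_alg M n) r) M"
proof (rule alg_homI)
  let ?A = "subalg (tuple_alg M n) r"
  show "(\<lambda>xs\<in>r. xs ! i) a \<in> univ M" if "a \<in> univ ?A" for a
    using that subsetD[OF compatible_relD(2)[OF r], of a] \<open>i < n\<close> by (auto simp: tuples_def)
  show "(\<lambda>xs\<in>r. xs ! i) \<in> extensional (univ ?A)"
    by simp
  fix f k as assume *: "Sg f = Some k" "length as = k" "set as \<subseteq> univ ?A"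
  moreover have "map (\<lambda>xs\<in>r. xs ! i) as = map (\<lambda>xs. xs ! i) as"
    using * by auto
  ultimately show "(\<lambda>xs\<in>r. xs ! i) (oper ?A f as) = oper M f (map (\<lambda>xs\<in>r. xs ! i) as)"
    using compatible_relD(3)[OF r *(1,2)] by (simp add: nth_oper_tuple_alg[OF \<open>i < n\<close>] del: map_eq_conv)
qed

section \<open>Terms and the enriched partial clone of an alter ego\<close>

locale finite_alter_ego =
  fixes Sg :: "'f sg" and M :: "('f, 'a) ualg" and H :: "'a pop set" and R :: "'a lrel set"
  assumes ualgebra_M: "ualgebra Sg M" and finite_M: "finite (univ M)"
    and alter_ego_M: "alter_ego Sg M H R"
begin

lemma H_compatible: "h \<in> H \<Longrightarrow> \<exists>n. compatible_pop Sg M n h"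
  using alter_ego_M unfolding alter_ego_def by blast

lemma R_compatible: "r \<in> R \<Longrightarrow> \<exists>n. compatible_rel Sg M n r"
  using alter_ego_M unfolding alter_ego_def by blast

lemma oper_M_closed: "Sg f = Some k \<Longrightarrow> length as = k \<Longrightarrow> set as \<subseteq> univ M \<Longrightarrow> oper M f as \<in> univ M"
  using ualgebra_M unfolding ualgebra_def closed_under_def tuples_def by auto

text \<open>The term can be defined on more tuples than \<open>f\<close>: a composite needs all its
  inner operations to be defined, the substituted term only those that occur in it. Richness asks
  for extensions, so agreement on the domain suffices. Non-emptiness of the domain is carried
  through the induction because it determines the arity.\<close>

lemma Clo_ep_extended_by_pterm:
  assumes "f \<in> Clo_ep (univ M) H"
  shows "dom f \<noteq> {} \<and> (\<exists>n t. dom f \<subseteq> tuples n (univ M) \<and> wf_pterm H n t \<and>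
    (\<forall>xs\<in>dom f. eval_pterm xs t = f xs))"
  using assms
proof induction
  case (base h)
  obtain n where n: "compatible_pop Sg M n h"
    using H_compatible[OF base] by blast
  have "wf_pterm H n (App h (map Var [0..<n]))"
    using base compatible_popD(2)[OF n] by (auto simp: tuples_def list_all_iff)
  moreover have "eval_pterm xs (App h (map Var [0..<n])) = h xs" if "xs \<in> dom h" for xs
    using that compatible_popD(2)[OF n] unfolding eval_App_map_Var by (auto simp: tuples_def map_nth_upt)
  ultimately show ?case
    using compatible_popD(1,2)[OF n] by blast
next
  case (proj i n)
  have d: "dom (proj (univ M) n i) = tuples n (univ M)"
    by (auto simp: proj_def split: if_splits)
  obtain a where "a \<in> univ M"
    using ualgebra_M unfolding ualgebra_def by auto
  then have "replicate n a \<in> tuples n (univ M)"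
    by (auto simp: tuples_def)
  moreover have "wf_pterm H n (Var i)" "\<forall>xs\<in>dom (proj (univ M) n i). eval_pterm xs (Var i) = proj (univ M) n i xs"
    using proj d by (auto simp: proj_def)
  ultimately show ?case
    unfolding d by blast
next
  case (comp f gs n)
  let ?p = "pcomp (univ M) n f gs"
  obtain m t where t: "dom f \<subseteq> tuples m (univ M)" "wf_pterm H m t" "\<forall>xs\<in>dom f. eval_pterm xs t = f xs"
    using comp by blast
  have m: "m = length gs"
    using t(1) comp.hyps(2) comp.IH(1) tuples_arity_unique by blast
  have "\<exists>u. wf_pterm H n u \<and> (\<forall>xs\<in>dom g. eval_pterm xs u = g xs)" if g: "g \<in> set gs" for g
  proof -
    obtain k u where u: "dom g \<noteq> {}" "dom g \<subseteq> tuples k (univ M)" "wf_pterm H k u" "\<forall>xs\<in>dom g. eval_pterm xs u = g xs"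
      using comp.IH(2)[OF g] by blast
    then have "k = n"
      using comp.hyps(4)[OF g] tuples_arity_unique by blast
    then show ?thesis
      using u by blast
  qed
  then obtain us where us: "length us = length gs"
    "\<And>i. i < length gs \<Longrightarrow> wf_pterm H n (us ! i) \<and> (\<forall>xs\<in>dom (gs ! i). eval_pterm xs (us ! i) = (gs ! i) xs)"
    using ex_map_of_list_all[of gs "\<lambda>g u. wf_pterm H n u \<and> (\<forall>xs\<in>dom g. eval_pterm xs u = g xs)"] by blast
  have wf: "wf_pterm H n (subst_pterm us t)"
    using t(2) us m by (intro wf_subst_pterm) (auto simp: list_all_length)
  have dp: "dom ?p \<subseteq> tuples n (univ M)"
    by (auto simp: pcomp_def split: if_splits)
  have "eval_pterm xs (subst_pterm us t) = ?p xs" if xs: "xs \<in> dom ?p" for xs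
  proof -
    have *: "xs \<in> tuples n (univ M)" "\<forall>g\<in>set gs. xs \<in> dom g" "?p xs = f (map (\<lambda>g. the (g xs)) gs)"
      using xs unfolding pcomp_def by (auto simp: domIff split: if_splits)
    have "map (eval_pterm xs) us = map Some (map (\<lambda>g. the (g xs)) gs)"
    proof (rule nth_equalityI)
      fix i assume "i < length (map (eval_pterm xs) us)"
      then have i: "i < length gs"
        using us(1) by simp
      then have "xs \<in> dom (gs ! i)"
        using *(2) by auto
      then show "map (eval_pterm xs) us ! i = map Some (map (\<lambda>g. the (g xs)) gs) ! i"
        using us i by (auto simp: domIff)
    qed (simp add: us(1))
    then have "eval_pterm xs (subst_pterm us t) = eval_pterm (map (\<lambda>g. the (g xs)) gs) t"
      using t(2) us(1) m by (intro eval_subst_pterm) auto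
    moreover have "map (\<lambda>g. the (g xs)) gs \<in> dom f"
      using xs *(3) by (auto simp: domIff)
    ultimately show ?thesis
      using t(3) *(3) by auto
  qed
  then show ?case
    using wf dp comp.hyps by blast
qed

text \<open>Undefinedness propagates outwards, so each argument is defined wherever the whole term
  is. This keeps all domains in the induction non-empty, as the composition rule of the clone
  demands.\<close>

lemma pterm_in_Clo_ep:
  assumes "wf_pterm H n t" "\<exists>xs\<in>tuples n (univ M). eval_pterm xs t \<noteq> None"
  shows "(\<lambda>xs. if xs \<in> tuples n (univ M) then eval_pterm xs t else None) \<in> Clo_ep (univ M) H"
  using assms
proof (induction t)
  case (Var i)
  have "(\<lambda>xs. if xs \<in> tuples n (univ M) then eval_pterm xs (Var i) else None) = proj (univ M) n i"
    by (auto simp: proj_def)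
  then show ?case
    using Var by (auto intro: Clo_ep.proj)
next
  case (App h ts)
  let ?F = "\<lambda>t xs. if xs \<in> tuples n (univ M) then eval_pterm xs t else None"
  have eq: "?F (App h ts) = pcomp (univ M) n h (map ?F ts)"
  proof
    fix xs
    show "?F (App h ts) xs = pcomp (univ M) n h (map ?F ts) xs"
    proof (cases "xs \<in> tuples n (univ M) \<and> None \<notin> set (map (eval_pterm xs) ts)")
      case True
      then have "map (\<lambda>g. the (g xs)) (map ?F ts) = map the (map (eval_pterm xs) ts)"
        by auto
      moreover have "xs \<in> tuples n (univ M) \<and> (\<forall>g\<in>set (map ?F ts). xs \<in> dom g)"
        using True by (auto simp: dom_def image_iff) (metis option.exhaust)
      ultimately show ?thesis
        using True unfolding pcomp_def eval_pterm.simps Let_def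
        by (simp only: if_P simp_thms if_False)
    next
      case False
      then show ?thesis
        unfolding pcomp_def by (auto simp: Let_def)
    qed
  qed
  have h: "h \<in> H" and len: "\<forall>xs\<in>dom h. length xs = length ts"
    using App.prems by auto
  obtain k where k: "compatible_pop Sg M k h"
    using H_compatible[OF h] by blast
  have "k = length ts"
    using compatible_popD(1,2)[OF k] len mem_tuples_iff by (metis all_not_in_conv subsetD)
  then have dh: "dom h \<subseteq> tuples (length (map ?F ts)) (univ M)"
    using compatible_popD(2)[OF k] by simp
  obtain xs where xs: "xs \<in> tuples n (univ M)" "eval_pterm xs (App h ts) \<noteq> None"
    using App.prems by blast
  show ?case
    unfolding eq
  proof (rule Clo_ep.comp[OF _ dh])
    show "h \<in> Clo_ep (univ M) H"
      by (rule Clo_ep.base[OF h])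
    show "dom (pcomp (univ M) n h (map ?F ts)) \<noteq> {}"
    proof -
      have "?F (App h ts) xs = eval_pterm xs (App h ts)"
        using xs(1) by (simp only: if_True)
      then have "xs \<in> dom (pcomp (univ M) n h (map ?F ts))"
        using fun_cong[OF eq, of xs] xs(2) by (simp only: domIff not_False_eq_True)
      then show ?thesis
        by blast
    qed
    fix g assume "g \<in> set (map ?F ts)"
    then obtain t where t: "t \<in> set ts" "g = ?F t"
      by auto
    have "eval_pterm xs t \<noteq> None"
      by (rule eval_App_args_defined[OF xs(2) t(1)])
    then show "g \<in> Clo_ep (univ M) H"
      using App.IH[OF t(1)] App.prems(1) t xs(1) by (auto simp: list_all_iff)
    show "dom g \<subseteq> tuples n (univ M)"
      unfolding t(2) by (auto split: if_splits)
  qed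
qed

text \<open>Together with \<open>op_rich_atI\<close> this restates richness as agreement with a term
  on the domain; the duality arguments then deal with terms only.\<close>

lemma op_rich_atD:
  assumes "op_rich_at Sg M H (dom h)" "compatible_pop Sg M n h"
  shows "\<exists>t. wf_pterm H n t \<and> (\<forall>xs\<in>dom h. eval_pterm xs t = h xs)"
proof -
  obtain g where g: "g \<in> Clo_ep (univ M) H" "h \<subseteq>\<^sub>m g"
    using assms unfolding op_rich_at_def by blast
  obtain k t where t: "dom g \<subseteq> tuples k (univ M)" "wf_pterm H k t" "\<forall>xs\<in>dom g. eval_pterm xs t = g xs"
    using Clo_ep_extended_by_pterm[OF g(1)] by blast
  have sub: "dom h \<subseteq> dom g"
    using g(2) by (rule map_le_implies_dom_le)
  have "k = n"
    using sub t(1) compatible_popD(1,2)[OF assms(2)] tuples_arity_unique by (metis subset_trans)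
  moreover have "\<forall>xs\<in>dom h. eval_pterm xs t = h xs"
    using t(3) sub g(2) unfolding map_le_def by (metis subsetD)
  ultimately show ?thesis
    using t(2) by blast
qed

lemma op_rich_atI:
  assumes "\<And>n h. compatible_pop Sg M n h \<Longrightarrow> dom h = r \<Longrightarrow>
      \<exists>t. wf_pterm H n t \<and> (\<forall>xs\<in>r. eval_pterm xs t = h xs)"
  shows "op_rich_at Sg M H r"
  unfolding op_rich_at_def
proof (intro allI impI)
  fix n h assume h: "compatible_pop Sg M n h \<and> dom h = r"
  then obtain t where t: "wf_pterm H n t" "\<forall>xs\<in>r. eval_pterm xs t = h xs"
    using assms by blast
  have r: "r \<noteq> {}" "r \<subseteq> tuples n (univ M)"
    using h compatible_popD(1,2) by blast+
  let ?g = "\<lambda>xs. if xs \<in> tuples n (univ M) then eval_pterm xs t else None"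
  have "h \<subseteq>\<^sub>m ?g"
    unfolding map_le_def using h t(2) r(2) by auto
  moreover have "?g \<in> Clo_ep (univ M) H"
    using r t h by (intro pterm_in_Clo_ep) (metis all_not_in_conv domIff subsetD)+
  ultimately show "\<exists>g\<in>Clo_ep (univ M) H. h \<subseteq>\<^sub>m g"
    by blast
qed

end

section \<open>Structures separated by morphisms into the alter ego\<close>

lemma finite_Hausdorff_imp_discrete:
  "finite (topspace X) \<Longrightarrow> Hausdorff_space X \<Longrightarrow> X = discrete_topology (topspace X)"
  by (metis Hausdorff_imp_t1_space finite_t1_space_imp_discrete_topology)

lemma topspace_ego [simp]: "pts (ego M) = univ M"
  and topo_ego: "topo (ego M) = discrete_topology (univ M)"
  and pops_ego [simp]: "pops (ego M) h = h"
  and rels_ego [simp]: "rels (ego M) r = r"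
  by (simp_all add: ego_def)

lemma pts_pow_tstr [simp]: "pts (pow_tstr (ego M) S) = S \<rightarrow>\<^sub>E univ M"
  by (simp add: pow_tstr_def)

lemma pts_induced [simp]: "pts (induced X B) = pts X \<inter> B"
  by (simp add: induced_def)

lemma Hausdorff_pow_ego: "Hausdorff_space (topo (pow_tstr (ego M) S))"
  by (simp add: pow_tstr_def topo_ego Hausdorff_space_product_topology)

lemma Hausdorff_induced_pow_ego: "Hausdorff_space (topo (induced (pow_tstr (ego M) S) B))"
  by (simp add: induced_def Hausdorff_space_subtopology Hausdorff_pow_ego)

text \<open>Working with the graph coordinate by coordinate avoids \<open>the\<close> and
  \<open>restrict\<close>; extensionality of \<open>y\<close> pins the value down outside
  \<open>S\<close>.\<close>

lemma pops_induced_pow_eq_Some: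
  "pops (induced (pow_tstr (ego M) S) B) h xs = Some y \<longleftrightarrow>
    set xs \<subseteq> B \<inter> (S \<rightarrow>\<^sub>E univ M) \<and> y \<in> extensional S \<and> (\<forall>s\<in>S. h (map (\<lambda>x. x s) xs) = Some (y s))"
proof -
  have "(\<forall>s\<in>S. map (\<lambda>x. x s) xs \<in> dom h) \<and> (\<lambda>s\<in>S. the (h (map (\<lambda>x. x s) xs))) = y \<longleftrightarrow>
      y \<in> extensional S \<and> (\<forall>s\<in>S. h (map (\<lambda>x. x s) xs) = Some (y s))"
    unfolding restrict_def extensional_def fun_eq_iff domIff
    by (auto simp del: map_map) (metis option.sel)+
  then show ?thesis
    by (auto simp: induced_def pow_tstr_def simp del: map_map split: if_splits)
qed

lemma rels_induced_pow:
  "xs \<in> rels (induced (pow_tstr (ego M) S) B) r \<longleftrightarrow>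
    set xs \<subseteq> B \<inter> (S \<rightarrow>\<^sub>E univ M) \<and> (\<forall>s\<in>S. map (\<lambda>x. x s) xs \<in> r)"
  by (auto simp: induced_def pow_tstr_def)

lemma morphD:
  assumes "u \<in> morph H R X Y"
  shows "u \<in> extensional (pts X)" "\<And>x. x \<in> pts X \<Longrightarrow> u x \<in> pts Y"
    "continuous_map (topo X) (topo Y) u"
    "\<And>h xs y. h \<in> H \<Longrightarrow> pops X h xs = Some y \<Longrightarrow> pops Y h (map u xs) = Some (u y)"
    "\<And>r xs. r \<in> R \<Longrightarrow> xs \<in> rels X r \<Longrightarrow> map u xs \<in> rels Y r"
  using assms unfolding morph_def by (auto simp: PiE_def)

lemma morphI:
  assumes "u \<in> extensional (pts X)" "\<And>x. x \<in> pts X \<Longrightarrow> u x \<in> pts Y"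
    "continuous_map (topo X) (topo Y) u"
    "\<And>h xs y. h \<in> H \<Longrightarrow> pops X h xs = Some y \<Longrightarrow> pops Y h (map u xs) = Some (u y)"
    "\<And>r xs. r \<in> R \<Longrightarrow> xs \<in> rels X r \<Longrightarrow> map u xs \<in> rels Y r"
  shows "u \<in> morph H R X Y"
  using assms unfolding morph_def by (auto simp: PiE_def)

text \<open>\<open>P\<close> may be smaller than the set of all morphisms, so that validity of a formula need only be
  tested on \<open>P\<close>; in applications it consists of the coordinate projections.\<close>

definition separates ::
    "('a, 'x) tstr \<Rightarrow> 'a pop set \<Rightarrow> 'a lrel set \<Rightarrow> ('f, 'a) ualg \<Rightarrow> ('x \<Rightarrow> 'a) set \<Rightarrow> bool" where
  "separates X H R M P \<longleftrightarrow>
     P \<noteq> {} \<and> P \<subseteq> morph H R X (ego M) \<and>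
     (\<forall>x\<in>pts X. \<forall>y\<in>pts X. (\<forall>p\<in>P. p x = p y) \<longrightarrow> x = y) \<and>
     (\<forall>h\<in>H. \<forall>xs. set xs \<subseteq> pts X \<longrightarrow> (\<forall>p\<in>P. map p xs \<in> dom h) \<longrightarrow>
        (\<exists>y\<in>pts X. pops X h xs = Some y)) \<and>
     (\<forall>r\<in>R. \<forall>xs. set xs \<subseteq> pts X \<longrightarrow> (\<forall>p\<in>P. map p xs \<in> r) \<longrightarrow> xs \<in> rels X r)"

lemma separatesD:
  assumes "separates X H R M P"
  shows "P \<noteq> {}" "\<And>p. p \<in> P \<Longrightarrow> p \<in> morph H R X (ego M)"
    "\<And>x y. x \<in> pts X \<Longrightarrow> y \<in> pts X \<Longrightarrow> (\<And>p. p \<in> P \<Longrightarrow> p x = p y) \<Longrightarrow> x = y"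
    "\<And>h xs. h \<in> H \<Longrightarrow> set xs \<subseteq> pts X \<Longrightarrow> (\<And>p. p \<in> P \<Longrightarrow> map p xs \<in> dom h) \<Longrightarrow>
        \<exists>y\<in>pts X. pops X h xs = Some y"
    "\<And>r xs. r \<in> R \<Longrightarrow> set xs \<subseteq> pts X \<Longrightarrow> (\<And>p. p \<in> P \<Longrightarrow> map p xs \<in> r) \<Longrightarrow> xs \<in> rels X r"
proof -
  note * = assms[unfolded separates_def]
  note ** = *[THEN conjunct2, THEN conjunct2]
  show "P \<noteq> {}" "\<And>p. p \<in> P \<Longrightarrow> p \<in> morph H R X (ego M)"
    using *[THEN conjunct1] *[THEN conjunct2, THEN conjunct1] by auto
  show "x = y" if "x \<in> pts X" "y \<in> pts X" "\<And>p. p \<in> P \<Longrightarrow> p x = p y" for x y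
    using **[THEN conjunct1] that by simp
  show "\<exists>y\<in>pts X. pops X h xs = Some y"
    if "h \<in> H" "set xs \<subseteq> pts X" "\<And>p. p \<in> P \<Longrightarrow> map p xs \<in> dom h" for h xs
    using **[THEN conjunct2, THEN conjunct1] that by (metis (no_types, lifting))
  show "xs \<in> rels X r" if "r \<in> R" "set xs \<subseteq> pts X" "\<And>p. p \<in> P \<Longrightarrow> map p xs \<in> r" for r xs
    using **[THEN conjunct2, THEN conjunct2] that by (metis (no_types, lifting))
qed

text \<open>The test on all members of the family is a premise of every clause, so a larger family
  of morphisms only strengthens the premises. In particular the set of all morphisms
  separates.\<close>

lemma separates_mono:
  assumes "separates X H R M P" "P \<subseteq> Q" "Q \<subseteq> morph H R X (ego M)"
  shows "separates X H R M Q"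
  unfolding separates_def
proof (intro conjI ballI allI impI)
  note D = separatesD[OF assms(1)]
  show "Q \<noteq> {}" "Q \<subseteq> morph H R X (ego M)"
    using D(1) assms(2,3) by auto
  show "x = y" if "x \<in> pts X" "y \<in> pts X" "\<forall>p\<in>Q. p x = p y" for x y
    using that assms(2) by (intro D(3)) auto
  show "\<exists>y\<in>pts X. pops X h xs = Some y"
    if "h \<in> H" "set xs \<subseteq> pts X" "\<forall>p\<in>Q. map p xs \<in> dom h" for h xs
    using that assms(2) by (intro D(4)) auto
  show "xs \<in> rels X r" if "r \<in> R" "set xs \<subseteq> pts X" "\<forall>p\<in>Q. map p xs \<in> r" for r xs
    using that assms(2) by (intro D(5)) auto
qed

text \<open>By induction the arguments have values in \<open>X\<close>. The outer operation is
  defined at their images under each \<open>p\<close> in \<open>P\<close>, hence in \<open>X\<close>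
  itself, and morphisms preserve the resulting value. In this way definedness spreads from
  \<open>P\<close> to all morphisms.\<close>

lemma eval_pterm_in_structure:
  assumes sep: "separates X H R M P" and "wf_pterm H (length xs) t" "set xs \<subseteq> pts X"
    and "\<And>p. p \<in> P \<Longrightarrow> eval_pterm (map p xs) t \<noteq> None"
  shows "\<exists>y\<in>pts X. \<forall>u\<in>morph H R X (ego M). eval_pterm (map u xs) t = Some (u y)"
  using assms(2,4)
proof (induction t)
  case (Var i)
  then show ?case
    using assms(3) by (intro bexI[of _ "xs ! i"]) auto
next
  case (App h ts)
  have "\<exists>y\<in>pts X. \<forall>u\<in>morph H R X (ego M). eval_pterm (map u xs) t = Some (u y)"
    if t: "t \<in> set ts" for t
  proof (rule App.IH[OF t])
    show "wf_pterm H (length xs) t"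
      using App.prems(1) t by (simp add: list_all_iff)
    show "eval_pterm (map p xs) t \<noteq> None" if "p \<in> P" for p
      by (rule eval_App_args_defined[OF App.prems(2)[OF that] t])
  qed
  then obtain ys where ys: "length ys = length ts" "\<And>i. i < length ts \<Longrightarrow> ys ! i \<in> pts X \<and>
      (\<forall>u\<in>morph H R X (ego M). eval_pterm (map u xs) (ts ! i) = Some (u (ys ! i)))"
    using ex_map_of_list_all[of ts "\<lambda>t y. y \<in> pts X \<and>
      (\<forall>u\<in>morph H R X (ego M). eval_pterm (map u xs) t = Some (u y))"] by blast
  have eval: "eval_pterm (map u xs) (App h ts) = h (map u ys)" if "u \<in> morph H R X (ego M)" for u
  proof -
    have "map (eval_pterm (map u xs)) ts = map Some (map u ys)"
      using ys that by (intro nth_equalityI) auto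
    then show ?thesis
      unfolding eval_pterm.simps Let_def by (auto simp: comp_def)
  qed
  have "h \<in> H"
    using App.prems(1) by simp
  moreover have "set ys \<subseteq> pts X"
    using ys by (auto simp: in_set_conv_nth)
  moreover have "map p ys \<in> dom h" if "p \<in> P" for p
    using App.prems(2)[OF that] eval[OF separatesD(2)[OF sep that]] by (simp only: domIff not_False_eq_True)
  ultimately obtain y where y: "y \<in> pts X" "pops X h ys = Some y"
    using separatesD(4)[OF sep] by blast
  then have "h (map u ys) = Some (u y)" if "u \<in> morph H R X (ego M)" for u
    using morphD(4)[OF that \<open>h \<in> H\<close> y(2)] by simp
  then show ?case
    using eval y(1) by auto
qed

text \<open>The terms of the atom have values in \<open>X\<close>. The two sides of an equation
  agree under \<open>P\<close> and are therefore the same point; a relation satisfied under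
  \<open>P\<close> already holds in \<open>X\<close>. Every morphism preserves these facts.\<close>

lemma holds_in_structure:
  assumes sep: "separates X H R M P" and wf: "wf_atomic H R (length xs) \<alpha>" and xs: "set xs \<subseteq> pts X"
    and P: "\<And>p. p \<in> P \<Longrightarrow> holds (map p xs) \<alpha>" and u: "u \<in> morph H R X (ego M)"
  shows "holds (map u xs) \<alpha>"
proof (cases \<alpha>)
  case (EqAtom s t)
  have "\<exists>y\<in>pts X. \<forall>u\<in>morph H R X (ego M). eval_pterm (map u xs) s = Some (u y)"
    using wf EqAtom P by (intro eval_pterm_in_structure[OF sep _ xs]) fastforce+
  then obtain y where y: "y \<in> pts X" "\<And>u. u \<in> morph H R X (ego M) \<Longrightarrow> eval_pterm (map u xs) s = Some (u y)"
    by blast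
  have "\<exists>z\<in>pts X. \<forall>u\<in>morph H R X (ego M). eval_pterm (map u xs) t = Some (u z)"
    using wf EqAtom P by (intro eval_pterm_in_structure[OF sep _ xs]) fastforce+
  then obtain z where z: "z \<in> pts X" "\<And>u. u \<in> morph H R X (ego M) \<Longrightarrow> eval_pterm (map u xs) t = Some (u z)"
    by blast
  have "p y = p z" if "p \<in> P" for p
    using P[OF that] y(2) z(2) separatesD(2)[OF sep that] EqAtom by auto
  then have "y = z"
    by (rule separatesD(3)[OF sep y(1) z(1)])
  then show ?thesis
    using y(2)[OF u] z(2)[OF u] EqAtom by simp
next
  case (RelAtom r ts)
  have "\<exists>y. y \<in> pts X \<and> (\<forall>u\<in>morph H R X (ego M). eval_pterm (map u xs) t = Some (u y))"
    if t: "t \<in> set ts" for t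
  proof -
    have "eval_pterm (map p xs) t \<noteq> None" if p: "p \<in> P" for p
    proof -
      obtain as where "map (eval_pterm (map p xs)) ts = map Some as"
        using P[OF p] RelAtom by auto
      then have "eval_pterm (map p xs) t \<in> set (map Some as)"
        using t by (metis imageI set_map)
      then show ?thesis
        by auto
    qed
    then show ?thesis
      using eval_pterm_in_structure[OF sep _ xs, of t] wf RelAtom t by (auto simp: list_all_iff)
  qed
  then obtain ys where ys: "length ys = length ts" "\<And>i. i < length ts \<Longrightarrow> ys ! i \<in> pts X \<and>
      (\<forall>u\<in>morph H R X (ego M). eval_pterm (map u xs) (ts ! i) = Some (u (ys ! i)))"
    using ex_map_of_list_all[of ts "\<lambda>t y. y \<in> pts X \<and>
      (\<forall>u\<in>morph H R X (ego M). eval_pterm (map u xs) t = Some (u y))"] by blast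
  have eval: "map (eval_pterm (map u xs)) ts = map Some (map u ys)" if "u \<in> morph H R X (ego M)" for u
    using ys that by (intro nth_equalityI) auto
  have "map p ys \<in> r" if "p \<in> P" for p
    using P[OF that] eval[OF separatesD(2)[OF sep that]] RelAtom
    by (auto simp: inj_map_eq_map simp del: map_map)
  moreover have "r \<in> R" "set ys \<subseteq> pts X"
    using wf RelAtom ys by (auto simp: in_set_conv_nth)
  ultimately have "ys \<in> rels X r"
    using separatesD(5)[OF sep] by blast
  then have "map u ys \<in> r"
    using morphD(5)[OF u \<open>r \<in> R\<close>] by simp
  then show ?thesis
    using eval[OF u] RelAtom by (auto simp del: map_map)
qed

section \<open>Structures isomorphic to substructures of powers, seen through their
  coordinates\<close>

definition coordinates :: "('a, 'x) tstr \<Rightarrow> 'i set \<Rightarrow> ('x \<Rightarrow> 'i \<Rightarrow> 'a) \<Rightarrow> ('x \<Rightarrow> 'a) set" where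
  "coordinates X S \<phi> = (\<lambda>s. \<lambda>x\<in>pts X. \<phi> x s) ` S"

text \<open>Values and relation instances that exist in every coordinate exist in the power, lie in
  the induced substructure on \<open>B\<close>, and are pulled back to \<open>X\<close> by the
  inverse isomorphism \<psi>. The family of coordinates is non-empty because \<open>S\<close>
  is.\<close>

lemma coordinates_separate:
  assumes "S \<noteq> {}" and closed: "pop_closed H (pow_tstr (ego M) S) B"
    and iso: "\<phi> \<in> tstr_iso H R X (induced (pow_tstr (ego M) S) B)"
    and wf: "wf_tstr H R X"
  shows "separates X H R M (coordinates X S \<phi>)"
proof -
  let ?Y = "induced (pow_tstr (ego M) S) B"
  have B: "B \<subseteq> S \<rightarrow>\<^sub>E univ M"
    using closed unfolding pop_closed_def by simp
  then have pts: "pts ?Y = B"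
    by auto
  obtain \<psi> where \<phi>: "\<phi> \<in> morph H R X ?Y" and \<psi>: "\<psi> \<in> morph H R ?Y X"
    and inv: "\<And>x. x \<in> pts X \<Longrightarrow> \<psi> (\<phi> x) = x" "\<And>y. y \<in> pts ?Y \<Longrightarrow> \<phi> (\<psi> y) = y"
    using iso unfolding tstr_iso_def by blast
  have \<phi>B: "\<phi> x \<in> B" if "x \<in> pts X" for x
    using morphD(2)[OF \<phi> that] pts by blast
  have \<psi>\<phi>: "map \<psi> (map \<phi> xs) = xs" if "set xs \<subseteq> pts X" for xs
    using that inv(1) unfolding map_map by (intro map_idI) auto
  have coord: "map (\<lambda>x\<in>pts X. \<phi> x s) xs = map (\<lambda>x. x s) (map \<phi> xs)" if "set xs \<subseteq> pts X" for xs s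
    using that by auto
  have sub: "set (map \<phi> xs) \<subseteq> B \<inter> (S \<rightarrow>\<^sub>E univ M)" if "set xs \<subseteq> pts X" for xs
  proof -
    have "set (map \<phi> xs) \<subseteq> B"
      using that \<phi>B by auto
    then show ?thesis
      using B by blast
  qed
  have wfX: "set xs \<subseteq> pts X \<and> y \<in> pts X" if "h \<in> H" "pops X h xs = Some y" for h xs y
    using wf that unfolding wf_tstr_def by blast
  have "(\<lambda>x\<in>pts X. \<phi> x s) \<in> morph H R X (ego M)" if s: "s \<in> S" for s
  proof (rule morphI)
    let ?p = "\<lambda>x\<in>pts X. \<phi> x s"
    show "?p x \<in> pts (ego M)" if "x \<in> pts X" for x
      using \<phi>B[OF that] B s that by auto
    have "continuous_map (topo ?Y) (topo (ego M)) (\<lambda>y. y s)"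
      using s by (auto simp: induced_def pow_tstr_def intro!: continuous_map_from_subtopology
          continuous_map_product_projection)
    then have "continuous_map (topo X) (topo (ego M)) ((\<lambda>y. y s) \<circ> \<phi>)"
      using morphD(3)[OF \<phi>] continuous_map_compose by blast
    then show "continuous_map (topo X) (topo (ego M)) ?p"
      by (rule continuous_map_eq) auto
    fix h xs y assume *: "h \<in> H" "pops X h xs = Some y"
    then show "pops (ego M) h (map ?p xs) = Some (?p y)"
      using morphD(4)[OF \<phi> *] wfX[OF *] s unfolding pops_induced_pow_eq_Some coord[OF conjunct1[OF wfX[OF *]]]
      by auto
  next
    let ?p = "\<lambda>x\<in>pts X. \<phi> x s"
    fix r xs assume *: "r \<in> R" "xs \<in> rels X r"
    then have xs: "set xs \<subseteq> pts X"
      using wf unfolding wf_tstr_def by blast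
    show "map ?p xs \<in> rels (ego M) r"
      using morphD(5)[OF \<phi> *] s unfolding rels_induced_pow coord[OF xs] by auto
  qed simp
  then have 1: "coordinates X S \<phi> \<subseteq> morph H R X (ego M)"
    unfolding coordinates_def by auto
  have 2: "x = y" if xy: "x \<in> pts X" "y \<in> pts X" and eq: "\<forall>p\<in>coordinates X S \<phi>. p x = p y" for x y
  proof -
    have "\<phi> x s = \<phi> y s" if "s \<in> S" for s
      using eq that xy unfolding coordinates_def by auto
    then have "\<phi> x = \<phi> y"
      using \<phi>B[OF xy(1)] \<phi>B[OF xy(2)] B by (intro PiE_ext[of _ S "\<lambda>_. univ M"]) auto
    then show ?thesis
      using inv(1) xy by metis
  qed
  have 3: "\<exists>y\<in>pts X. pops X h xs = Some y"
    if h: "h \<in> H" and xs: "set xs \<subseteq> pts X" and d: "\<forall>p\<in>coordinates X S \<phi>. map p xs \<in> dom h" for h xs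
  proof -
    have d': "map (\<lambda>x. x s) (map \<phi> xs) \<in> dom h" if "s \<in> S" for s
      using d that unfolding coordinates_def coord[OF xs, symmetric] by blast
    let ?y = "\<lambda>s\<in>S. the (h (map (\<lambda>x. x s) (map \<phi> xs)))"
    have "pops ?Y h (map \<phi> xs) = Some ?y"
      unfolding pops_induced_pow_eq_Some using d' sub[OF xs] by (auto simp: dom_def)
    then have "pops X h (map \<psi> (map \<phi> xs)) = Some (\<psi> ?y)"
      by (rule morphD(4)[OF \<psi> h])
    then show ?thesis
      using \<psi>\<phi>[OF xs] wfX[OF h] by auto
  qed
  have 4: "xs \<in> rels X r"
    if r: "r \<in> R" and xs: "set xs \<subseteq> pts X" and d: "\<forall>p\<in>coordinates X S \<phi>. map p xs \<in> r" for r xs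
  proof -
    have "map (\<lambda>x. x s) (map \<phi> xs) \<in> r" if "s \<in> S" for s
      using d that unfolding coordinates_def coord[OF xs, symmetric] by blast
    then have "map \<phi> xs \<in> rels ?Y r"
      unfolding rels_induced_pow using sub[OF xs] by blast
    then have "map \<psi> (map \<phi> xs) \<in> rels X r"
      by (rule morphD(5)[OF \<psi> r])
    then show ?thesis
      using \<psi>\<phi>[OF xs] by simp
  qed
  show ?thesis
    unfolding separates_def using 1 2 3 4 \<open>S \<noteq> {}\<close> by (auto simp: coordinates_def)
qed

text \<open>Powers of the discrete alter ego are Hausdorff, and this passes back along the injective
  continuous map \<phi>. As a consequence, continuity of maps out of a finite \<open>X\<close> is
  automatic.\<close>

lemma discrete_of_tstr_iso:
  assumes "\<phi> \<in> tstr_iso H R X (induced (pow_tstr (ego M) S) B)" and fin: "finite (pts X)"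
  shows "topo X = discrete_topology (pts X)"
proof -
  let ?Y = "induced (pow_tstr (ego M) S) B"
  obtain \<psi> where \<phi>: "\<phi> \<in> morph H R X ?Y" and \<psi>: "\<psi> \<in> morph H R ?Y X"
    and inv: "\<And>x. x \<in> pts X \<Longrightarrow> \<psi> (\<phi> x) = x" "\<And>y. y \<in> pts ?Y \<Longrightarrow> \<phi> (\<psi> y) = y"
    using assms unfolding tstr_iso_def by blast
  have "Hausdorff_space (topo X)"
  proof (rule Hausdorff_space_injective_preimage)
    show "continuous_map (topo X) (topo ?Y) \<phi>"
      by (rule morphD(3)[OF \<phi>])
    show "inj_on \<phi> (pts X)"
      by (rule inj_on_inverseI[of _ \<psi>]) (rule inv(1))
  qed (rule Hausdorff_induced_pow_ego)
  then show ?thesis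
    using fin by (intro finite_Hausdorff_imp_discrete)
qed

section \<open>Homomorphisms and the evaluation map of an algebra\<close>

lemma set_subset_imageE:
  assumes "set ys \<subseteq> f ` A"
  obtains xs where "set xs \<subseteq> A" "ys = map f xs"
proof -
  have "ys \<in> lists (f ` A)"
    using assms by (simp add: lists_eq_set)
  then obtain xs where "xs \<in> lists A" "ys = map f xs"
    unfolding lists_image by blast
  then show thesis
    using that by (simp add: lists_eq_set)
qed

lemma finite_alg_hom: "finite (univ A) \<Longrightarrow> finite (univ M) \<Longrightarrow> finite (alg_hom Sg A M)"
  using finite_subset[of "alg_hom Sg A M" "univ A \<rightarrow>\<^sub>E univ M"] finite_PiE[of "univ A" "\<lambda>_. univ M"]
  unfolding alg_hom_def by blast

text \<open>A homomorphism on the image relation, composed with the listing map, is a homomorphism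
  on \<open>A\<close>; it occurs in the list at some position and so is the projection to that
  position. If \<open>A\<close> has no homomorphism to \<open>M\<close>, the relation is the nullary
  one containing the empty tuple.\<close>

lemma hom_minimal_of_all_homs:
  assumes A: "ualgebra Sg A" and \<phi>s: "set \<phi>s = alg_hom Sg A M"
  shows "hom_minimal Sg M ((\<lambda>a. map (\<lambda>\<phi>. \<phi> a) \<phi>s) ` univ A)"
proof -
  let ?t = "\<lambda>a. map (\<lambda>\<phi>. \<phi> a) \<phi>s" and ?n = "length \<phi>s"
  let ?r = "?t ` univ A"
  have hom: "\<phi>s ! i \<in> alg_hom Sg A M" if "i < ?n" for i
    using nth_mem[OF that] unfolding \<phi>s .
  have A_closed: "oper A f as \<in> univ A" if "Sg f = Some k" "length as = k" "set as \<subseteq> univ A" for f k as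
    using A that unfolding ualgebra_def closed_under_def tuples_def by auto
  have t_hom: "oper (tuple_alg M ?n) f (map ?t as) = ?t (oper A f as)"
    if "Sg f = Some k" "length as = k" "set as \<subseteq> univ A" for f k as
  proof (rule nth_equalityI)
    fix i assume "i < length (oper (tuple_alg M ?n) f (map ?t as))"
    then have i: "i < ?n"
      by simp
    then have "map (\<lambda>xs. xs ! i) (map ?t as) = map (\<phi>s ! i) as"
      by simp
    then show "oper (tuple_alg M ?n) f (map ?t as) ! i = ?t (oper A f as) ! i"
      using i alg_homD(3)[OF hom[OF i] that] by (simp only: nth_oper_tuple_alg nth_map)
  qed simp
  have comp: "compatible_rel Sg M ?n ?r"
  proof (rule compatible_relI)
    show "?r \<noteq> {}"
      using A unfolding ualgebra_def by simp
    show "?r \<subseteq> tuples ?n (univ M)"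
      using alg_homD(1)[of _ Sg A M] \<phi>s unfolding tuples_def by auto
    fix f k xss assume *: "Sg f = Some k" "length xss = k" "set xss \<subseteq> ?r"
    obtain as where "set as \<subseteq> univ A" "xss = map ?t as"
      by (rule set_subset_imageE[OF *(3)])
    then show "oper (tuple_alg M ?n) f xss \<in> ?r"
      using t_hom[of f k as] A_closed[of f k as] * by auto
  qed
  have "\<exists>i<?n. \<forall>xs\<in>?r. \<psi> xs = xs ! i" if \<psi>: "\<psi> \<in> alg_hom Sg (subalg (tuple_alg M ?n) ?r) M" for \<psi>
  proof -
    have "(\<lambda>a\<in>univ A. \<psi> (?t a)) \<in> alg_hom Sg A M"
    proof (rule alg_homI)
      show "(\<lambda>a\<in>univ A. \<psi> (?t a)) a \<in> univ M" if "a \<in> univ A" for a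
        using alg_homD(1)[OF \<psi>, of "?t a"] imageI[OF that, of ?t] that
        by (simp only: univ_subalg restrict_apply if_True)
      fix f k as assume *: "Sg f = Some k" "length as = k" "set as \<subseteq> univ A"
      have "\<psi> (oper (tuple_alg M ?n) f (map ?t as)) = oper M f (map \<psi> (map ?t as))"
        using alg_homD(3)[OF \<psi> *(1), of "map ?t as"] * by auto
      moreover have "map \<psi> (map ?t as) = map (\<lambda>a\<in>univ A. \<psi> (?t a)) as"
        using * by auto
      ultimately show "(\<lambda>a\<in>univ A. \<psi> (?t a)) (oper A f as) = oper M f (map (\<lambda>a\<in>univ A. \<psi> (?t a)) as)"
        using t_hom[OF *] A_closed[OF *] by (simp only: restrict_apply if_True)
    qed simp
    then obtain i where i: "i < ?n" "\<phi>s ! i = (\<lambda>a\<in>univ A. \<psi> (?t a))"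
      using \<phi>s by (metis in_set_conv_nth)
    then have "\<psi> (?t a) = ?t a ! i" if "a \<in> univ A" for a
      using that by simp
    then show ?thesis
      using i(1) by blast
  qed
  then show ?thesis
    unfolding hom_minimal_def using comp by blast
qed

section \<open>Dual structures of algebras and the map \<eta>\<close>

lemma univ_dual_E [simp]: "univ (dual_E M H R X) = morph H R X (ego M)"
  by (simp add: dual_E_def)

lemma oper_dual_E: "oper (dual_E M H R X) f us = (\<lambda>x\<in>pts X. oper M f (map (\<lambda>u. u x) us))"
  by (simp add: dual_E_def pow_alg_def)

lemma pts_dual_D [simp]: "pts (dual_D Sg M A) = alg_hom Sg A M"
  unfolding dual_D_def alg_hom_def by auto

lemma restrict_id_in_tstr_iso:
  assumes "wf_tstr H R X"
  shows "(\<lambda>x\<in>pts X. x) \<in> tstr_iso H R X X"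
proof -
  have m: "map (\<lambda>x\<in>pts X. x) xs = xs" if "set xs \<subseteq> pts X" for xs
    using that by (intro map_idI) auto
  have "(\<lambda>x\<in>pts X. x) \<in> morph H R X X"
  proof (rule morphI)
    show "continuous_map (topo X) (topo X) (\<lambda>x\<in>pts X. x)"
      by (rule continuous_map_eq[OF continuous_map_id]) simp
    show "pops X h (map (\<lambda>x\<in>pts X. x) xs) = Some ((\<lambda>x\<in>pts X. x) y)"
      if "h \<in> H" "pops X h xs = Some y" for h xs y
      using that assms m[of xs] unfolding wf_tstr_def by auto
    show "map (\<lambda>x\<in>pts X. x) xs \<in> rels X r" if "r \<in> R" "xs \<in> rels X r" for r xs
      using that assms m[of xs] unfolding wf_tstr_def by auto
  qed auto
  then show ?thesis
    unfolding tstr_iso_def by (auto intro!: bexI[of _ "\<lambda>x\<in>pts X. x"])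
qed

context finite_alter_ego
begin

lemma pop_closed_pts_induced:
  assumes "pop_closed H (pow_tstr (ego M) S) B"
  shows "pts (induced (pow_tstr (ego M) S) B) = B"
  using assms unfolding pop_closed_def by auto

lemma wf_induced_pow:
  assumes "S \<noteq> {}" and closed: "pop_closed H (pow_tstr (ego M) S) B"
  shows "wf_tstr H R (induced (pow_tstr (ego M) S) B)"
proof -
  obtain s where s: "s \<in> S"
    using assms by blast
  let ?Y = "induced (pow_tstr (ego M) S) B"
  have "set xs \<subseteq> B \<and> y \<in> B \<and> (\<forall>as\<in>dom h. length as = length xs)"
    if h: "h \<in> H" and y: "pops ?Y h xs = Some y" for h xs y
  proof -
    obtain n where n: "compatible_pop Sg M n h"
      using H_compatible[OF h] by blast
    have "map (\<lambda>x. x s) xs \<in> dom h"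
      using y s unfolding pops_induced_pow_eq_Some by blast
    then have "length xs = n"
      using compatible_popD(2)[OF n] by (auto simp: tuples_def)
    then have "\<forall>as\<in>dom h. length as = length xs"
      using compatible_popD(2)[OF n] by (auto simp: tuples_def)
    moreover have "set xs \<subseteq> B" "pops (pow_tstr (ego M) S) h xs = Some y"
      using y by (simp_all add: induced_def split: if_splits)
    ultimately show ?thesis
      using closed h unfolding pop_closed_def by blast
  qed
  moreover have "set xs \<subseteq> B \<and> (\<forall>as\<in>r. length as = length xs)" if r: "r \<in> R" and xs: "xs \<in> rels ?Y r" for r xs
  proof -
    obtain n where n: "compatible_rel Sg M n r"
      using R_compatible[OF r] by blast
    have "map (\<lambda>x. x s) xs \<in> r"
      using xs s unfolding rels_induced_pow by blast
    then have "length xs = n"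
      using compatible_relD(2)[OF n] by (auto simp: tuples_def)
    then show ?thesis
      using compatible_relD(2)[OF n] xs unfolding rels_induced_pow by (auto simp: tuples_def)
  qed
  ultimately show ?thesis
    unfolding wf_tstr_def pop_closed_pts_induced[OF closed] by blast
qed

text \<open>A compatible partial operation commutes with the operations of \<open>M\<close>: the
  matrix with entries \<open>x a\<close>, for \<open>x\<close> in \<open>xs\<close> and
  \<open>a\<close> in \<open>as\<close>, may be evaluated by rows or by columns.\<close>

lemma alg_hom_pop_closed:
  assumes "ualgebra Sg A"
  shows "pop_closed H (pow_tstr (ego M) (univ A)) (alg_hom Sg A M)"
  unfolding pop_closed_def
proof (intro conjI ballI allI impI)
  show "alg_hom Sg A M \<subseteq> pts (pow_tstr (ego M) (univ A))"
    by (auto simp: alg_hom_def)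
  fix h xs y
  assume h: "h \<in> H" and xs: "set xs \<subseteq> alg_hom Sg A M"
    and "pops (pow_tstr (ego M) (univ A)) h xs = Some y"
  then have "pops (induced (pow_tstr (ego M) (univ A)) (alg_hom Sg A M)) h xs = Some y"
    by (simp add: induced_def)
  then have y: "y \<in> extensional (univ A)" "\<And>a. a \<in> univ A \<Longrightarrow> h (map (\<lambda>x. x a) xs) = Some (y a)"
    unfolding pops_induced_pow_eq_Some by auto
  obtain n where n: "compatible_pop Sg M n h"
    using H_compatible[OF h] by blast
  show "y \<in> alg_hom Sg A M"
  proof (rule alg_homI[OF _ y(1)])
    show "y a \<in> univ M" if "a \<in> univ A" for a
      using compatible_popD(3)[OF n y(2)[OF that]] .
    fix f k as assume *: "Sg f = Some k" "length as = k" "set as \<subseteq> univ A"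
    then have fa: "oper A f as \<in> univ A"
      using assms unfolding ualgebra_def closed_under_def tuples_def by auto
    let ?t = "\<lambda>a. map (\<lambda>x. x a) xs"
    have len: "length xs = n"
      using y(2)[OF fa] compatible_popD(2)[OF n] by (auto simp: tuples_def dom_def)
    have "set (map ?t as) \<subseteq> dom h"
      using *(3) y(2) by auto
    then have "h (oper (tuple_alg M n) f (map ?t as)) = Some (oper M f (map (\<lambda>xs. the (h xs)) (map ?t as)))"
      using * by (intro compatible_popD(4)[OF n]) auto
    moreover have "map (\<lambda>xs. the (h xs)) (map ?t as) = map y as"
      using *(3) y(2) by auto
    moreover have "oper (tuple_alg M n) f (map ?t as) = ?t (oper A f as)"
    proof (rule nth_equalityI)
      fix i assume "i < length (oper (tuple_alg M n) f (map ?t as))"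
      then have i: "i < n"
        by simp
      then have "xs ! i \<in> alg_hom Sg A M"
        using xs len by auto
      moreover have "map (\<lambda>xs. xs ! i) (map ?t as) = map (xs ! i) as"
        using i len by simp
      ultimately show "oper (tuple_alg M n) f (map ?t as) ! i = ?t (oper A f as) ! i"
        using i len alg_homD(3)[of "xs ! i" Sg A M, OF _ *] by (simp only: nth_oper_tuple_alg nth_map)
    qed (simp add: len)
    ultimately show "y (oper A f as) = oper M f (map y as)"
      using y(2)[OF fa] by (simp only: option.inject)
  qed
qed

text \<open>D(A) is already an induced substructure of a power, so the identity serves as the
  isomorphism, and the coordinates are the evaluations \<eta>(a). In particular these are
  morphisms.\<close>

lemma dual_D_separates:
  assumes A: "ualgebra Sg A"
  shows "separates (dual_D Sg M A) H R M (eta Sg M A ` univ A)"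
proof -
  let ?X = "dual_D Sg M A"
  have ne: "univ A \<noteq> {}"
    using A unfolding ualgebra_def by blast
  note closed = alg_hom_pop_closed[OF A]
  have wf: "wf_tstr H R ?X"
    unfolding dual_D_def by (rule wf_induced_pow[OF ne closed])
  have "(\<lambda>x\<in>pts ?X. x) \<in> tstr_iso H R ?X (induced (pow_tstr (ego M) (univ A)) (alg_hom Sg A M))"
    using restrict_id_in_tstr_iso[OF wf] by (simp only: dual_D_def)
  then have "separates ?X H R M (coordinates ?X (univ A) (\<lambda>x\<in>pts ?X. x))"
    by (rule coordinates_separate[OF ne closed _ wf])
  moreover have "coordinates ?X (univ A) (\<lambda>x\<in>pts ?X. x) = eta Sg M A ` univ A"
    unfolding coordinates_def eta_def by (intro image_cong refl) (auto simp: restrict_def)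
  ultimately show ?thesis
    by simp
qed

lemma eta_iso:
  assumes hm: "\<And>r. hom_minimal Sg M r \<Longrightarrow> r \<in> Rel_ca (univ M) H R"
    and A: "A \<in> ISP TYPE('i) Sg M" and fin: "finite (univ A)"
  shows "eta Sg M A \<in> alg_iso Sg A (dual_E M H R (dual_D Sg M A))"
proof -
  let ?X = "dual_D Sg M A" and ?e = "eta Sg M A"
  have alg: "ualgebra Sg A"
    using A unfolding ISP_def by blast
  note sep = dual_D_separates[OF alg]
  have e: "?e a = (\<lambda>x\<in>alg_hom Sg A M. x a)" if "a \<in> univ A" for a
    using that by (simp add: eta_def)
  have e_Mor: "?e a \<in> morph H R ?X (ego M)" if "a \<in> univ A" for a
    using separatesD(2)[OF sep] that by blast
  have hom: "?e \<in> alg_hom Sg A (dual_E M H R ?X)"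
  proof (rule alg_homI)
    show "?e \<in> extensional (univ A)"
      by (simp add: eta_def)
    show "?e a \<in> univ (dual_E M H R ?X)" if "a \<in> univ A" for a
      using e_Mor[OF that] by simp
    fix f k as assume *: "Sg f = Some k" "length as = k" "set as \<subseteq> univ A"
    then have fa: "oper A f as \<in> univ A"
      using alg unfolding ualgebra_def closed_under_def tuples_def by auto
    have "x (oper A f as) = oper M f (map (\<lambda>u. u x) (map ?e as))" if x: "x \<in> alg_hom Sg A M" for x
    proof -
      have "map (\<lambda>u. u x) (map ?e as) = map x as"
        using * x e by auto
      then show ?thesis
        using alg_homD(3)[OF x *] by (simp only:)
    qed
    then show "?e (oper A f as) = oper (dual_E M H R ?X) f (map ?e as)"
      unfolding e[OF fa] oper_dual_E pts_dual_D by (intro restrict_ext)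
  qed
  have inj: "inj_on ?e (univ A)"
  proof (rule inj_onI)
    fix a b assume ab: "a \<in> univ A" "b \<in> univ A" and eq: "?e a = ?e b"
    obtain S :: "'i set" and B \<phi> where B: "subuniverse Sg (pow_alg M S) B"
      and \<phi>: "\<phi> \<in> alg_iso Sg A (subalg (pow_alg M S) B)"
      using A unfolding ISP_def by blast
    have \<phi>_hom: "\<phi> \<in> alg_hom Sg A (subalg (pow_alg M S) B)" and \<phi>_inj: "inj_on \<phi> (univ A)"
      using \<phi> unfolding alg_iso_def bij_betw_def by auto
    have \<phi>B: "\<phi> c \<in> S \<rightarrow>\<^sub>E univ M" if "c \<in> univ A" for c
      using alg_homD(1)[OF \<phi>_hom that] B by (auto simp: subuniverse_def pow_alg_def)
    have "\<phi> a s = \<phi> b s" if s: "s \<in> S" for s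
    proof -
      \<comment> \<open>Each coordinate of the embedding into a power is a homomorphism to
        \<open>M\<close>, and \<eta>(a) = \<eta>(b) means that no homomorphism tells
        \<open>a\<close> and \<open>b\<close> apart.\<close>
      have "(\<lambda>c\<in>univ A. \<phi> c s) \<in> alg_hom Sg A M"
      proof (rule alg_homI)
        show "(\<lambda>c\<in>univ A. \<phi> c s) c \<in> univ M" if "c \<in> univ A" for c
          using \<phi>B[OF that] that s by auto
        fix f k as assume *: "Sg f = Some k" "length as = k" "set as \<subseteq> univ A"
        then have "oper A f as \<in> univ A"
          using alg unfolding ualgebra_def closed_under_def tuples_def by auto
        moreover have "map (\<lambda>x. x s) (map \<phi> as) = map (\<lambda>c\<in>univ A. \<phi> c s) as"
          using *(3) by auto
        ultimately show "(\<lambda>c\<in>univ A. \<phi> c s) (oper A f as) = oper M f (map (\<lambda>c\<in>univ A. \<phi> c s) as)"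
          using alg_homD(3)[OF \<phi>_hom *] s by (simp add: pow_alg_def del: map_map map_eq_conv)
      qed simp
      then show ?thesis
        using fun_cong[OF eq, of "\<lambda>c\<in>univ A. \<phi> c s"] ab by (simp add: e)
    qed
    then have "\<phi> a = \<phi> b"
      using \<phi>B ab by (intro PiE_ext[of _ S "\<lambda>_. univ M"]) auto
    then show "a = b"
      using \<phi>_inj ab by (auto dest: inj_onD)
  qed
  have "\<exists>a\<in>univ A. u = ?e a" if u: "u \<in> morph H R ?X (ego M)" for u
  proof -
    obtain \<phi>s where \<phi>s: "set \<phi>s = alg_hom Sg A M"
      using finite_list[OF finite_alg_hom[OF fin finite_M]] by blast
    let ?t = "\<lambda>a. map (\<lambda>\<phi>. \<phi> a) \<phi>s"
    obtain n \<Phi> where \<Phi>: "list_all (wf_atomic H R n) \<Phi>" "?t ` univ A = ca_defined (univ M) n \<Phi>"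
      using hm[OF hom_minimal_of_all_homs[OF alg \<phi>s]] unfolding Rel_ca_def by blast
    obtain a\<^sub>0 where "a\<^sub>0 \<in> univ A"
      using alg unfolding ualgebra_def by blast
    then have "?t a\<^sub>0 \<in> ca_defined (univ M) n \<Phi>"
      using \<Phi>(2) by blast
    then have n: "n = length \<phi>s"
      unfolding ca_defined_def tuples_def by simp
    have t: "?t a = map (?e a) \<phi>s" if "a \<in> univ A" for a
      using that \<phi>s by (auto simp: e)
    \<comment> \<open>The tuples of the listed relation are the images of \<open>\<phi>s\<close>
      under the evaluations \<eta>(a), which form the separating family; what holds for all of these
      holds for the morphism \<open>u\<close>.\<close>
    have "holds (map u \<phi>s) \<alpha>" if \<alpha>: "\<alpha> \<in> set \<Phi>" for \<alpha>
    proof (rule holds_in_structure[OF sep _ _ _ u])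
      show "wf_atomic H R (length \<phi>s) \<alpha>"
        using \<Phi>(1) \<alpha> n by (auto simp: list_all_iff)
      show "set \<phi>s \<subseteq> pts ?X"
        using \<phi>s by simp
      fix p assume "p \<in> ?e ` univ A"
      then obtain a where a: "a \<in> univ A" "p = ?e a"
        by blast
      then have "?t a \<in> ca_defined (univ M) n \<Phi>"
        using \<Phi>(2) by blast
      then show "holds (map p \<phi>s) \<alpha>"
        using \<alpha> t[OF a(1)] a(2) unfolding ca_defined_def by simp
    qed
    moreover have "map u \<phi>s \<in> tuples n (univ M)"
      using morphD(2)[OF u] \<phi>s n by (auto simp: tuples_def)
    ultimately have "map u \<phi>s \<in> ?t ` univ A"
      unfolding \<Phi>(2) ca_defined_def by blast
    then obtain a where a: "a \<in> univ A" "map u \<phi>s = ?t a"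
      by blast
    then have "u x = x a" if "x \<in> alg_hom Sg A M" for x
      using that \<phi>s by auto
    then have "u = ?e a"
      using morphD(1)[OF u] unfolding e[OF a(1)] by (intro extensionalityI[of _ "alg_hom Sg A M"]) auto
    then show ?thesis
      using a(1) by blast
  qed
  then have "?e ` univ A = univ (dual_E M H R ?X)"
    using e_Mor by auto
  then show ?thesis
    unfolding alg_iso_def bij_betw_def using hom inj by simp
qed

end

section \<open>The evaluation map of a structure\<close>

lemma continuous_map_of_discrete:
  "topo X = discrete_topology U \<Longrightarrow> (\<And>x. x \<in> U \<Longrightarrow> g x \<in> topspace Y) \<Longrightarrow> continuous_map (topo X) Y g"
  by (simp add: Pi_iff)

text \<open>Recording a morphism by its values along \<open>xs\<close> turns the pointwise
  operations of E(X) into those of a finite power. This is how E(X) is treated as a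
  relation.\<close>

lemma oper_tuple_alg_rows:
  assumes "set xs \<subseteq> D"
  shows "oper (tuple_alg A (length xs)) f (map (\<lambda>u. map u xs) us) =
    map (\<lambda>x\<in>D. oper A f (map (\<lambda>u. u x) us)) xs"
proof (rule nth_equalityI)
  fix i assume "i < length (oper (tuple_alg A (length xs)) f (map (\<lambda>u. map u xs) us))"
  then have i: "i < length xs"
    by simp
  then have "map (\<lambda>ys. ys ! i) (map (\<lambda>u. map u xs) us) = map (\<lambda>u. u (xs ! i)) us"
    by simp
  moreover have "xs ! i \<in> D"
    using assms i by auto
  ultimately show "oper (tuple_alg A (length xs)) f (map (\<lambda>u. map u xs) us) ! i =
      map (\<lambda>x\<in>D. oper A f (map (\<lambda>u. u x) us)) xs ! i"
    using i by (simp only: nth_oper_tuple_alg nth_map restrict_apply if_True)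
qed simp

context finite_alter_ego
begin

lemma dual_E_closed:
  assumes wf: "wf_tstr H R X" and disc: "topo X = discrete_topology (pts X)"
    and us: "set us \<subseteq> morph H R X (ego M)" and f: "Sg f = Some k" "length us = k"
  shows "oper (dual_E M H R X) f us \<in> morph H R X (ego M)"
  unfolding oper_dual_E
proof (rule morphI)
  let ?v = "\<lambda>x\<in>pts X. oper M f (map (\<lambda>u. u x) us)"
  show v: "?v x \<in> pts (ego M)" if x: "x \<in> pts X" for x
  proof -
    have "set (map (\<lambda>u. u x) us) \<subseteq> univ M"
      using us morphD(2)[OF _ x, of _ H R "ego M"] by auto
    then show ?thesis
      using oper_M_closed[OF f(1), of "map (\<lambda>u. u x) us"] f(2) x by simp
  qed
  then show "continuous_map (topo X) (topo (ego M)) ?v"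
    by (rule continuous_map_of_discrete[OF disc])
  show "pops (ego M) h (map ?v xs) = Some (?v y)" if h: "h \<in> H" and y: "pops X h xs = Some y" for h xs y
  proof -
    have xy: "set xs \<subseteq> pts X" "y \<in> pts X"
      using wf h y unfolding wf_tstr_def by blast+
    have u: "h (map u xs) = Some (u y)" if "u \<in> morph H R X (ego M)" for u
      using morphD(4)[OF that h y] by simp
    obtain n where n: "compatible_pop Sg M n h"
      using H_compatible[OF h] by blast
    show ?thesis
    proof (cases "us = []")
      case True
      have "oper M f [] \<in> univ M"
        using oper_M_closed f True by auto
      show ?thesis
      proof -
        \<comment> \<open>For a nullary operation symbol there is no morphism in \<open>us\<close>
          that would carry \<open>xs\<close> into the domain of \<open>h\<close>, so the length of
          \<open>xs\<close> comes from the well-formedness of \<open>X\<close>.\<close>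
        obtain as where as: "as \<in> dom h"
          using compatible_popD(1)[OF n] by blast
        have len: "length xs = n"
          using wf h y as compatible_popD(2)[OF n] unfolding wf_tstr_def by (metis mem_tuples_iff subsetD)
        have "h (oper (tuple_alg M n) f []) = Some (oper M f [])"
          using compatible_popD(4)[OF n f(1), of "[]"] f(2) True by simp
        then show ?thesis
          using oper_tuple_alg_rows[OF xy(1), of M f us] xy(2) len True by simp
      qed
    next
      case False
      then obtain u where "u \<in> morph H R X (ego M)"
        using us by (metis hd_in_set subsetD)
      then have len: "length xs = n"
        using u compatible_popD(2)[OF n] by (metis domI length_map mem_tuples_iff subsetD)
      have "set (map (\<lambda>u. map u xs) us) \<subseteq> dom h"
        using u us by auto
      then have "h (oper (tuple_alg M n) f (map (\<lambda>u. map u xs) us)) =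
          Some (oper M f (map (\<lambda>ys. the (h ys)) (map (\<lambda>u. map u xs) us)))"
        using f by (intro compatible_popD(4)[OF n]) auto
      moreover have "map (\<lambda>ys. the (h ys)) (map (\<lambda>u. map u xs) us) = map (\<lambda>u. u y) us"
        using u us by auto
      ultimately show ?thesis
        using oper_tuple_alg_rows[OF xy(1), of M f us] xy(2) len by (simp del: map_map map_eq_conv)
    qed
  qed
  show "map ?v xs \<in> rels (ego M) r" if r: "r \<in> R" and xs: "xs \<in> rels X r" for r xs
  proof -
    have xsX: "set xs \<subseteq> pts X"
      using wf r xs unfolding wf_tstr_def by blast
    obtain n where n: "compatible_rel Sg M n r"
      using R_compatible[OF r] by blast
    obtain as where "as \<in> r"
      using compatible_relD(1)[OF n] by blast
    then have len: "length xs = n"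
      using wf r xs compatible_relD(2)[OF n] unfolding wf_tstr_def by (metis mem_tuples_iff subsetD)
    have "set (map (\<lambda>u. map u xs) us) \<subseteq> r"
      using us morphD(5)[OF _ r xs, of _ H "ego M"] by auto
    then have "oper (tuple_alg M n) f (map (\<lambda>u. map u xs) us) \<in> r"
      using f by (intro compatible_relD(3)[OF n]) auto
    then show ?thesis
      using oper_tuple_alg_rows[OF xsX, of M f us] len by simp
  qed
qed simp

lemma hom_dual_E_is_evaluation:
  assumes sep: "separates X H R M P" and wf: "wf_tstr H R X"
    and disc: "topo X = discrete_topology (pts X)" and xs: "set xs = pts X"
    and rich: "op_rich_at Sg M H ((\<lambda>u. map u xs) ` morph H R X (ego M))"
    and \<psi>: "\<psi> \<in> alg_hom Sg (dual_E M H R X) M"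
  shows "\<exists>x\<in>pts X. \<forall>u\<in>morph H R X (ego M). \<psi> u = u x"
proof -
  let ?Mor = "morph H R X (ego M)" and ?row = "\<lambda>u. map u xs"
  let ?r = "?row ` ?Mor"
  \<comment> \<open>As \<open>xs\<close> runs through all points, a row determines its morphism, and
    \<psi> can be transported to a partial operation on rows.\<close>
  have inj: "inj_on ?row ?Mor"
  proof (rule inj_onI)
    fix u v assume uv: "u \<in> ?Mor" "v \<in> ?Mor" and "map u xs = map v xs"
    then have "\<forall>x\<in>pts X. u x = v x"
      using xs by simp
    then show "u = v"
      using morphD(1)[OF uv(1)] morphD(1)[OF uv(2)] by (intro extensionalityI[of _ "pts X"]) auto
  qed
  define h where "h ys = (if ys \<in> ?r then Some (\<psi> (inv_into ?Mor ?row ys)) else None)" for ys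
  have h: "h (?row u) = Some (\<psi> u)" if "u \<in> ?Mor" for u
    using imageI[OF that, of ?row] inv_into_f_f[OF inj that] unfolding h_def by (simp only: if_True)
  have dom_h: "dom h = ?r"
    unfolding h_def by (auto split: if_splits)
  have "compatible_pop Sg M (length xs) h"
  proof (rule compatible_popI)
    show "dom h \<noteq> {}"
      unfolding dom_h using separatesD(1,2)[OF sep] by blast
    show "dom h \<subseteq> tuples (length xs) (univ M)"
      unfolding dom_h tuples_def using xs morphD(2)[of _ H R X "ego M"] by auto
    show "y \<in> univ M" if "h ys = Some y" for ys y
    proof -
      have "ys \<in> ?r"
        using that dom_h by blast
      then obtain u where "u \<in> ?Mor" "ys = ?row u"
        by blast
      then show ?thesis
        using h[of u] that alg_homD(1)[OF \<psi>, of u] by simp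
    qed
    fix f k xss assume *: "Sg f = Some k" "length xss = k" "set xss \<subseteq> dom h"
    obtain us where us: "set us \<subseteq> ?Mor" "xss = map ?row us"
      using set_subset_imageE[OF *(3)[unfolded dom_h]] by blast
    then have len: "length us = k"
      using *(2) by simp
    have v: "oper (dual_E M H R X) f us \<in> ?Mor"
      by (rule dual_E_closed[OF wf disc us(1) *(1) len])
    have "oper (tuple_alg M (length xs)) f xss = ?row (oper (dual_E M H R X) f us)"
      unfolding us(2) oper_dual_E by (rule oper_tuple_alg_rows) (simp add: xs)
    moreover have "\<psi> (oper (dual_E M H R X) f us) = oper M f (map \<psi> us)"
      using alg_homD(3)[OF \<psi> *(1) len] us(1) by simp
    moreover have "map (\<lambda>ys. the (h ys)) xss = map \<psi> us"
      unfolding us(2) using h us(1) by auto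
    ultimately show "h (oper (tuple_alg M (length xs)) f xss) = Some (oper M f (map (\<lambda>ys. the (h ys)) xss))"
      using h[OF v] by (simp only:)
  qed
  then obtain t where t: "wf_pterm H (length xs) t" "\<forall>ys\<in>dom h. eval_pterm ys t = h ys"
    using op_rich_atD rich dom_h by metis
  have eval: "eval_pterm (?row u) t = Some (\<psi> u)" if "u \<in> ?Mor" for u
    using t(2) h[OF that] that dom_h by auto
  \<comment> \<open>The term is defined on every row, so it has a value when evaluated in
    \<open>X\<close> at the points \<open>xs\<close>; this value is the point at which \<psi>
    evaluates.\<close>
  have "\<exists>y\<in>pts X. \<forall>u\<in>?Mor. eval_pterm (?row u) t = Some (u y)"
    using eval separatesD(2)[OF sep] xs by (intro eval_pterm_in_structure[OF sep t(1)]) auto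
  then show ?thesis
    using eval by fastforce
qed

text \<open>The assumption \<open>evaluation\<close> is surjectivity. What remains is that facts
  valid under every morphism hold in \<open>X\<close> itself, which makes the map injective and its
  inverse a morphism; this is separation by the set of all morphisms.\<close>

lemma eps_iso:
  assumes sep: "separates X H R M P" and wf: "wf_tstr H R X"
    and disc: "topo X = discrete_topology (pts X)" and fin: "finite (pts X)"
    and evaluation: "\<And>\<psi>. \<psi> \<in> alg_hom Sg (dual_E M H R X) M \<Longrightarrow>
      \<exists>x\<in>pts X. \<forall>u\<in>morph H R X (ego M). \<psi> u = u x"
  shows "eps M H R X \<in> tstr_iso H R X (dual_D Sg M (dual_E M H R X))"
proof -
  let ?Mor = "morph H R X (ego M)" and ?e = "eps M H R X"
  let ?E = "dual_E M H R X"
  let ?Y = "dual_D Sg M ?E"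
  have sepM: "separates X H R M ?Mor"
    using separates_mono[OF sep _ subset_refl] separatesD(2)[OF sep] by blast
  have Y: "?Y = induced (pow_tstr (ego M) ?Mor) (alg_hom Sg ?E M)"
    by (simp add: dual_D_def)
  have alg_E: "ualgebra Sg ?E"
    unfolding ualgebra_def closed_under_def
    using dual_E_closed[OF wf disc] separatesD(1)[OF sepM] by (auto simp: tuples_def)
  have e: "?e x = (\<lambda>u\<in>?Mor. u x)" if "x \<in> pts X" for x
    using that by (simp add: eps_def)
  have e_hom: "?e x \<in> alg_hom Sg ?E M" if x: "x \<in> pts X" for x
  proof (rule alg_homI)
    show "?e x u \<in> univ M" if "u \<in> univ ?E" for u
      using morphD(2)[of u H R X "ego M", OF _ x] that x by (simp add: e)
    show "?e x \<in> extensional (univ ?E)"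
      using x by (simp add: e)
    fix f k us assume *: "Sg f = Some k" "length us = k" "set us \<subseteq> univ ?E"
    then have "oper ?E f us \<in> ?Mor"
      using dual_E_closed[OF wf disc _ *(1,2)] by simp
    moreover have "map (?e x) us = map (\<lambda>u. u x) us"
      using * x by (auto simp: e)
    ultimately show "?e x (oper ?E f us) = oper M f (map (?e x) us)"
      using x by (simp add: e oper_dual_E del: map_eq_conv)
  qed
  have e_inj: "x = y" if "x \<in> pts X" "y \<in> pts X" "?e x = ?e y" for x y
  proof (rule separatesD(3)[OF sepM that(1,2)])
    fix u assume "u \<in> ?Mor"
    then show "u x = u y"
      using fun_cong[OF that(3), of u] that(1,2) by (simp add: e)
  qed
  have e_surj: "\<exists>x\<in>pts X. \<psi> = ?e x" if \<psi>: "\<psi> \<in> alg_hom Sg ?E M" for \<psi>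
  proof -
    obtain x where x: "x \<in> pts X" "\<forall>u\<in>?Mor. \<psi> u = u x"
      using evaluation[OF \<psi>] by blast
    have "\<psi> = ?e x"
      using alg_homD(2)[OF \<psi>] x by (intro extensionalityI[of _ ?Mor]) (auto simp: e)
    then show ?thesis
      using x(1) by blast
  qed
  have image: "?e ` pts X = pts ?Y"
    using e_hom e_surj by auto
  have coord: "map (\<lambda>\<psi>. \<psi> u) (map ?e xs) = map u xs" if "u \<in> ?Mor" "set xs \<subseteq> pts X" for u xs
    using that by (auto simp: e)
  have e_morph: "?e \<in> morph H R X ?Y"
  proof (rule morphI)
    show "?e \<in> extensional (pts X)"
      by (simp add: eps_def)
    show pt: "?e x \<in> pts ?Y" if "x \<in> pts X" for x
      using e_hom[OF that] by simp
    then show "continuous_map (topo X) (topo ?Y) ?e"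
      by (rule continuous_map_of_discrete[OF disc])
    have sub: "set (map ?e xs) \<subseteq> alg_hom Sg ?E M \<inter> (?Mor \<rightarrow>\<^sub>E univ M)" if "set xs \<subseteq> pts X" for xs
      using that e_hom by (auto simp: alg_hom_def)
    show "pops ?Y h (map ?e xs) = Some (?e y)" if h: "h \<in> H" and y: "pops X h xs = Some y" for h xs y
    proof -
      have xy: "set xs \<subseteq> pts X" "y \<in> pts X"
        using wf h y unfolding wf_tstr_def by blast+
      have "h (map u xs) = Some (u y)" if "u \<in> ?Mor" for u
        using morphD(4)[OF that h y] by simp
      then have "\<forall>u\<in>?Mor. h (map (\<lambda>\<psi>. \<psi> u) (map ?e xs)) = Some (?e y u)"
        using coord[OF _ xy(1)] xy(2) by (simp add: e del: map_map)
      then show ?thesis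
        unfolding Y pops_induced_pow_eq_Some using sub[OF xy(1)] xy(2) by (auto simp: e)
    qed
    show "map ?e xs \<in> rels ?Y r" if r: "r \<in> R" and xs: "xs \<in> rels X r" for r xs
    proof -
      have xsX: "set xs \<subseteq> pts X"
        using wf r xs unfolding wf_tstr_def by blast
      have "map u xs \<in> r" if "u \<in> ?Mor" for u
        using morphD(5)[OF that r xs] by simp
      then have "\<forall>u\<in>?Mor. map (\<lambda>\<psi>. \<psi> u) (map ?e xs) \<in> r"
        using coord[OF _ xsX] by (simp del: map_map)
      then show ?thesis
        unfolding Y rels_induced_pow using sub[OF xsX] by blast
    qed
  qed
  let ?g = "\<lambda>\<psi>\<in>pts ?Y. inv_into (pts X) ?e \<psi>"
  have inj: "inj_on ?e (pts X)"
    using e_inj by (auto intro: inj_onI)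
  have ge: "?g (?e x) = x" if "x \<in> pts X" for x
    using that e_hom[OF that] inv_into_f_f[OF inj that] by simp
  have eg: "?e (?g \<psi>) = \<psi>" and g_pt: "?g \<psi> \<in> pts X" if "\<psi> \<in> pts ?Y" for \<psi>
    using that f_inv_into_f[of \<psi> ?e "pts X"] inv_into_into[of \<psi> ?e "pts X"] image by auto
  have wfY: "wf_tstr H R ?Y"
    unfolding Y using wf_induced_pow[OF separatesD(1)[OF sepM]] alg_hom_pop_closed[OF alg_E] by simp
  have lift: "\<exists>xs. set xs \<subseteq> pts X \<and> ys = map ?e xs" if "set ys \<subseteq> pts ?Y" for ys
    using set_subset_imageE[of ys ?e "pts X"] that image by metis
  have g_map: "map ?g (map ?e xs) = xs" if "set xs \<subseteq> pts X" for xs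
    unfolding map_map comp_apply using that by (intro map_idI) (simp only: comp_apply ge subsetD)
  have g_morph: "?g \<in> morph H R ?Y X"
  proof (rule morphI)
    show "?g \<psi> \<in> pts X" if "\<psi> \<in> pts ?Y" for \<psi>
      using g_pt[OF that] .
    have "topo ?Y = discrete_topology (pts ?Y)"
    proof (rule finite_Hausdorff_imp_discrete)
      show "finite (pts ?Y)"
        using fin image by (metis finite_imageI)
      show "Hausdorff_space (topo ?Y)"
        unfolding Y by (rule Hausdorff_induced_pow_ego)
    qed
    then show "continuous_map (topo ?Y) (topo X) ?g"
      using g_pt by (rule continuous_map_of_discrete)
    show "pops X h (map ?g ys) = Some (?g \<psi>)" if h: "h \<in> H" and \<psi>: "pops ?Y h ys = Some \<psi>" for h ys \<psi>
    proof -
      have ys: "set ys \<subseteq> pts ?Y" "\<psi> \<in> pts ?Y"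
        using wfY h \<psi> unfolding wf_tstr_def by blast+
      obtain xs where xs: "set xs \<subseteq> pts X" "ys = map ?e xs"
        using lift[OF ys(1)] by blast
      have *: "h (map u xs) = Some (\<psi> u)" if "u \<in> ?Mor" for u
      proof -
        have "h (map (\<lambda>\<psi>. \<psi> u) ys) = Some (\<psi> u)"
          using \<psi> that unfolding Y pops_induced_pow_eq_Some by blast
        then show ?thesis
          using coord[OF that xs(1)] xs(2) by (simp only:)
      qed
      \<comment> \<open>Definedness in the double dual is definedness under every morphism, and
        separation turns it into a value in \<open>X\<close>.\<close>
      then obtain y where y: "y \<in> pts X" "pops X h xs = Some y"
        using separatesD(4)[OF sepM h xs(1)] by blast
      have "pops ?Y h ys = Some (?e y)"
        using morphD(4)[OF e_morph h y(2)] xs(2) by simp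
      then have "\<psi> = ?e y"
        using \<psi> by simp
      then show ?thesis
        using y g_map[OF xs(1)] ge[OF y(1)] xs(2) by (simp only:)
    qed
    show "map ?g ys \<in> rels X r" if r: "r \<in> R" and ysr: "ys \<in> rels ?Y r" for r ys
    proof -
      have ys: "set ys \<subseteq> pts ?Y"
        using wfY r ysr unfolding wf_tstr_def by blast
      obtain xs where xs: "set xs \<subseteq> pts X" "ys = map ?e xs"
        using lift[OF ys(1)] by blast
      have "map u xs \<in> r" if "u \<in> ?Mor" for u
      proof -
        have "map (\<lambda>\<psi>. \<psi> u) ys \<in> r"
          using ysr that unfolding Y rels_induced_pow by blast
        then show ?thesis
          using coord[OF that xs(1)] xs(2) by (simp only:)
      qed
      then have "xs \<in> rels X r"
        by (rule separatesD(5)[OF sepM r xs(1)])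
      then show ?thesis
        using g_map[OF xs(1)] xs(2) by (simp only:)
    qed
  qed simp
  show ?thesis
    unfolding tstr_iso_def using e_morph g_morph ge eg by blast
qed

text \<open>A tuple \<open>v\<close> satisfying every atom over hom-minimal relations that is valid
  on the rows is read as a map on the points of \<open>X\<close>. This map must be shown to respect
  \<open>H\<close> and \<open>R\<close>, although the formulas may mention neither of them.\<close>

lemma morphisms_ca_definable:
  assumes sep: "separates X H R M P" and wf: "wf_tstr H R X"
    and disc: "topo X = discrete_topology (pts X)" and xs: "set xs = pts X" "distinct xs"
    and rich: "\<And>\<rho>. \<rho> \<in> R \<union> {dom h | h. h \<in> H} \<Longrightarrow> op_rich_at Sg M H \<rho>"
  shows "(\<lambda>u. map u xs) ` morph H R X (ego M) \<in> ca_definable_from_hom_minimal Sg M"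
proof -
  let ?Mor = "morph H R X (ego M)" and ?row = "\<lambda>u. map u xs"
  let ?r = "?row ` ?Mor" and ?HM = "{r. hom_minimal Sg M r}" and ?n = "length xs"
  have sepM: "separates X H R M ?Mor"
    using separates_mono[OF sep _ subset_refl] separatesD(2)[OF sep] by blast
  have r_tuples: "?r \<subseteq> tuples ?n (univ M)"
    unfolding tuples_def using xs morphD(2)[of _ H R X "ego M"] by auto
  \<comment> \<open>\<open>idx\<close> gives the position of a point in the list. Distinctness makes
    it a two-sided inverse of indexing, so that \<open>v\<close> is exactly the row of the map
    \<open>?u\<close>.\<close>
  have "\<exists>idx. \<forall>x\<in>pts X. idx x < ?n \<and> xs ! idx x = x"
    unfolding xs(1)[symmetric] by (rule bchoice) (auto simp: in_set_conv_nth)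
  then obtain idx where idx: "\<And>x. x \<in> pts X \<Longrightarrow> idx x < ?n \<and> xs ! idx x = x"
    by blast
  have idx_nth: "idx (xs ! i) = i" if "i < ?n" for i
  proof -
    have "xs ! i \<in> pts X"
      using nth_mem[OF that] xs(1) by simp
    then show ?thesis
      using idx[of "xs ! i"] nth_eq_iff_index_eq[OF xs(2) _ that, of "idx (xs ! i)"] by simp
  qed
  have "v \<in> ?r" if v: "v \<in> tuples ?n (univ M)"
    and atoms: "\<And>\<alpha>. wf_atomic {} ?HM ?n \<alpha> \<Longrightarrow> \<forall>ys\<in>?r. holds ys \<alpha> \<Longrightarrow> holds v \<alpha>" for v
  proof -
    let ?u = "\<lambda>x\<in>pts X. v ! idx x"
    have u_idx: "map ((!) v) (map idx ys) = map ?u ys" if "set ys \<subseteq> pts X" for ys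
      using that by auto
    have u_row: "?row ?u = v"
      using v idx_nth xs(1) by (auto simp: tuples_def intro!: nth_equalityI)
    text \<open>By richness the homomorphisms on \<open>\<rho>\<close> are term operations, hence map tuples of points of
      \<open>X\<close> to points of \<open>X\<close>. Listing their values turns an instance of \<open>\<rho>\<close> in \<open>X\<close> into an
      instance of a hom-minimal relation.\<close>
    have preserve: "map ?u as \<in> \<rho> \<and>
        (\<forall>\<theta>\<in>alg_hom Sg (subalg (tuple_alg M k) \<rho>) M. \<forall>y\<in>pts X.
          (\<forall>w\<in>?Mor. \<theta> (map w as) = w y) \<longrightarrow> ?u y = \<theta> (map ?u as))"
      if comp: "compatible_rel Sg M k \<rho>" and \<rho>: "op_rich_at Sg M H \<rho>" and as: "set as \<subseteq> pts X"
        and in_\<rho>: "\<And>w. w \<in> ?Mor \<Longrightarrow> map w as \<in> \<rho>" for k \<rho> as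
    proof -
      let ?A = "subalg (tuple_alg M k) \<rho>"
      have alg_A: "ualgebra Sg ?A"
        unfolding ualgebra_def closed_under_def using compatible_relD[OF comp] by (auto simp: mem_tuples_iff)
      have "finite \<rho>"
        using finite_subset[OF compatible_relD(2)[OF comp] finite_tuples[OF finite_M]] .
      then obtain \<phi>s where \<phi>s: "set \<phi>s = alg_hom Sg ?A M"
        using finite_list[OF finite_alg_hom[of ?A M Sg]] finite_M by auto
      obtain w where w: "w \<in> ?Mor"
        using separatesD(1)[OF sepM] by blast
      have len: "length as = k"
        using in_\<rho>[OF w] compatible_relD(2)[OF comp] by (auto simp: tuples_def)
      have "\<exists>y. y \<in> pts X \<and> (\<forall>w\<in>?Mor. \<theta> (map w as) = w y)" if \<theta>: "\<theta> \<in> set \<phi>s" for \<theta>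
      proof -
        let ?h = "\<lambda>ys. if ys \<in> \<rho> then Some (\<theta> ys) else None"
        have d: "dom ?h = \<rho>"
          by (auto split: if_splits)
        have "compatible_pop Sg M k ?h"
          using \<theta> \<phi>s by (intro compatible_pop_of_alg_hom[OF comp]) simp
        then obtain t where t: "wf_pterm H k t" "\<forall>ys\<in>dom ?h. eval_pterm ys t = ?h ys"
          using op_rich_atD[of ?h k] \<rho> d by metis
        then have eval: "eval_pterm (map w as) t = Some (\<theta> (map w as))" if "w \<in> ?Mor" for w
          using in_\<rho>[OF that] unfolding d by simp
        have "\<exists>y\<in>pts X. \<forall>w\<in>?Mor. eval_pterm (map w as) t = Some (w y)"
          using t(1) len eval by (intro eval_pterm_in_structure[OF sepM _ as]) auto
        then show ?thesis
          using eval by fastforce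
      qed
      then obtain ys where ys: "length ys = length \<phi>s" "\<And>i. i < length \<phi>s \<Longrightarrow>
          ys ! i \<in> pts X \<and> (\<forall>w\<in>?Mor. (\<phi>s ! i) (map w as) = w (ys ! i))"
        using ex_map_of_list_all[of \<phi>s "\<lambda>\<theta> y. y \<in> pts X \<and> (\<forall>w\<in>?Mor. \<theta> (map w as) = w y)"] by blast
      have ysX: "set ys \<subseteq> pts X"
        using ys by (auto simp: in_set_conv_nth)
      let ?\<sigma> = "(\<lambda>a. map (\<lambda>\<phi>. \<phi> a) \<phi>s) ` univ ?A"
      let ?\<alpha> = "RelAtom ?\<sigma> (map Var (map idx ys))"
      have "wf_atomic {} ?HM ?n ?\<alpha>"
        using hom_minimal_of_all_homs[OF alg_A \<phi>s] ys(1) ysX idx by (auto simp: list_all_iff)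
      moreover have "holds (?row w) ?\<alpha>" if w: "w \<in> ?Mor" for w
      proof -
        have "map ((!) (?row w)) (map idx ys) = map w ys"
          using ysX idx by auto
        also have "\<dots> = map (\<lambda>\<phi>. \<phi> (map w as)) \<phi>s"
          using ys w by (intro nth_equalityI) auto
        also have "\<dots> \<in> ?\<sigma>"
          unfolding univ_subalg by (rule imageI[OF in_\<rho>[OF w]])
        finally show ?thesis
          unfolding holds_RelAtom_map_Var .
      qed
      ultimately have "holds v ?\<alpha>"
        using atoms by blast
      then have "map ?u ys \<in> ?\<sigma>"
        unfolding holds_RelAtom_map_Var u_idx[OF ysX] .
      then obtain a where a: "a \<in> \<rho>" "map ?u ys = map (\<lambda>\<phi>. \<phi> a) \<phi>s"
        by auto
      \<comment> \<open>By separation \<open>y\<close> is the very point chosen for \<theta> in the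
        list \<open>ys\<close>, so its value under \<open>?u\<close> is the entry of the listing of
        \<open>a\<close> at \<theta>.\<close>
      have hom_value: "?u y = \<theta> a" if \<theta>: "\<theta> \<in> alg_hom Sg ?A M" and y: "y \<in> pts X"
        and eq: "\<forall>w\<in>?Mor. \<theta> (map w as) = w y" for \<theta> y
      proof -
        obtain i where i: "i < length \<phi>s" "\<theta> = \<phi>s ! i"
          using \<theta> \<phi>s by (metis in_set_conv_nth)
        have "y = ys ! i"
          using ys(2)[OF i(1)] eq i(2) by (intro separatesD(3)[OF sepM y]) auto
        then show ?thesis
          using arg_cong[OF a(2), of "\<lambda>l. l ! i"] i ys(1) by simp
      qed
      \<comment> \<open>The projections of \<rho> are among its homomorphisms, and the point
        belonging to the \<open>i\<close>-th projection is \<open>as ! i\<close>.\<close>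
      have "map ?u as = a"
      proof (rule nth_equalityI)
        show la: "length (map ?u as) = length a"
          using len a(1) compatible_relD(2)[OF comp] by (auto simp: tuples_def)
        fix i assume "i < length (map ?u as)"
        then have i: "i < k"
          using len by simp
        then have "as ! i \<in> pts X"
          using as len by auto
        moreover have "\<forall>w\<in>?Mor. (\<lambda>ys\<in>\<rho>. ys ! i) (map w as) = w (as ! i)"
          using in_\<rho> i len by simp
        ultimately have "?u (as ! i) = (\<lambda>ys\<in>\<rho>. ys ! i) a"
          by (intro hom_value projection_in_alg_hom[OF comp i])
        then show "map ?u as ! i = a ! i"
          using i len a(1) by simp
      qed
      then show ?thesis
        using hom_value a(1) by blast
    qed
    have "?u \<in> ?Mor"
    proof (rule morphI)
      show u: "?u x \<in> pts (ego M)" if "x \<in> pts X" for x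
        using v idx[OF that] that by (auto simp: tuples_def)
      then show "continuous_map (topo X) (topo (ego M)) ?u"
        by (rule continuous_map_of_discrete[OF disc])
      show "pops (ego M) h (map ?u as) = Some (?u y)" if h: "h \<in> H" and y: "pops X h as = Some y" for h as y
      proof -
        have asy: "set as \<subseteq> pts X" "y \<in> pts X"
          using wf h y unfolding wf_tstr_def by blast+
        obtain k where k: "compatible_pop Sg M k h"
          using H_compatible[OF h] by blast
        have *: "h (map w as) = Some (w y)" if "w \<in> ?Mor" for w
          using morphD(4)[OF that h y] by simp
        \<comment> \<open>A partial operation is a homomorphism on its domain; with
          \<open>dom h\<close> as the relation, \<open>preserve\<close> yields both definedness and
          the value.\<close>
        let ?\<theta> = "\<lambda>ys\<in>dom h. the (h ys)"
        have "\<forall>w\<in>?Mor. ?\<theta> (map w as) = w y"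
          using * by (simp add: dom_def)
        moreover have "op_rich_at Sg M H (dom h)"
          using rich h by blast
        ultimately have "map ?u as \<in> dom h \<and> ?u y = ?\<theta> (map ?u as)"
          using preserve[OF compatible_rel_dom[OF k] _ asy(1)] * alg_hom_of_compatible_pop[OF k] asy(2) by blast
        then show ?thesis
          by auto
      qed
      show "map ?u as \<in> rels (ego M) \<rho>" if \<rho>: "\<rho> \<in> R" and as: "as \<in> rels X \<rho>" for \<rho> as
      proof -
        have "set as \<subseteq> pts X"
          using wf \<rho> as unfolding wf_tstr_def by blast
        moreover obtain k where k: "compatible_rel Sg M k \<rho>"
          using R_compatible[OF \<rho>] by blast
        moreover have "map w as \<in> \<rho>" if "w \<in> ?Mor" for w
          using morphD(5)[OF that \<rho> as] by simp
        ultimately show ?thesis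
          using preserve[OF k, of as] rich \<rho> by simp
      qed
    qed simp
    then show ?thesis
      using u_row by (metis imageI)
  qed
  then have "\<exists>\<Phi>. list_all (wf_atomic {} ?HM ?n) \<Phi> \<and> ?r = ca_defined (univ M) ?n \<Phi>"
    by (intro ca_definedI[OF finite_M r_tuples]) blast
  moreover have "?r \<noteq> {}"
    using separatesD(1)[OF sepM] by blast
  ultimately show ?thesis
    unfolding ca_definable_from_hom_minimal_def Rel_ca_def by blast
qed

end

section \<open>From full duality to definability and richness\<close>

lemma ex_inj_on_infinite_type:
  assumes "finite B" "infinite (UNIV :: 'u set)"
  shows "\<exists>g :: 'b \<Rightarrow> 'u. inj_on g B"
proof -
  obtain T :: "'u set" where T: "finite T" "card T = card B"
    using infinite_arbitrarily_large[OF assms(2), of "card B"] by blast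
  obtain g where "bij_betw g B T"
    using finite_same_card_bij[OF assms(1) T(1)] T(2) by auto
  then show ?thesis
    by (auto simp: bij_betw_def)
qed

context finite_alter_ego
begin

lemma finite_compatible_rel: "compatible_rel Sg M n r \<Longrightarrow> finite r"
  by (rule finite_subset[OF compatible_relD(2) finite_tuples[OF finite_M]])

text \<open>Full duality speaks only of algebras with elements and index sets in \<open>'u\<close>.
  So both the finitely many tuples of \<open>r\<close> (by \<open>e\<close>) and its
  \<open>n\<close> coordinates (by \<open>g\<close>) are renamed; arity 0 leads to the zero
  power.\<close>

lemma ex_copy_in_ISP:
  assumes universe: "infinite (UNIV :: 'u set)" and r: "compatible_rel Sg M n r"
  shows "\<exists>(A :: ('f, 'u) ualg) e. A \<in> ISP TYPE('u) Sg M \<and> finite (univ A) \<and> bij_betw e r (univ A) \<and>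
    (\<forall>f k xss. Sg f = Some k \<longrightarrow> length xss = k \<longrightarrow> set xss \<subseteq> r \<longrightarrow>
      oper A f (map e xss) = e (oper (tuple_alg M n) f xss))"
proof -
  obtain e :: "'a list \<Rightarrow> 'u" where e: "inj_on e r"
    using ex_inj_on_infinite_type[OF finite_compatible_rel[OF r] universe] by blast
  obtain g :: "nat \<Rightarrow> 'u" where g: "inj_on g {..<n}"
    using ex_inj_on_infinite_type[OF _ universe, of "{..<n}"] by auto
  let ?e' = "inv_into r e" and ?S = "g ` {..<n}"
  let ?A = "\<lparr>univ = e ` r, oper = (\<lambda>f as. e (oper (tuple_alg M n) f (map ?e' as)))\<rparr> :: ('f, 'u) ualg"
  let ?\<kappa> = "\<lambda>a. \<lambda>s\<in>?S. a ! inv_into {..<n} g s"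
  have e': "?e' (e a) = a" if "a \<in> r" for a
    using inv_into_f_f[OF e that] .
  have map_e': "map ?e' (map e xss) = xss" if "set xss \<subseteq> r" for xss
    unfolding map_map using that e' by (intro map_idI) (simp only: comp_apply subsetD)
  have \<kappa>: "?\<kappa> a (g i) = a ! i" if "i < n" for a :: "'a list" and i
    using that inv_into_f_f[OF g, of i] by simp
  have oper_A: "oper ?A f (map e xss) = e (oper (tuple_alg M n) f xss)" if "set xss \<subseteq> r" for f xss
    using map_e'[OF that] by simp
  have alg_A: "ualgebra Sg ?A"
    unfolding ualgebra_def closed_under_def
  proof (intro conjI allI impI)
    show "univ ?A \<noteq> {}"
      using compatible_relD(1)[OF r] by simp
    fix f k as assume f: "Sg f = Some k" and as: "as \<in> tuples k (univ ?A)"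
    then obtain xss where "set xss \<subseteq> r" "as = map e xss"
      using set_subset_imageE[of as e r] by (auto simp: tuples_def)
    then show "oper ?A f as \<in> univ ?A"
      using oper_A[of xss f] compatible_relD(3)[OF r f, of xss] as by (auto simp: tuples_def)
  qed
  have \<kappa>_oper: "oper (pow_alg M ?S) f (map ?\<kappa> xss) = ?\<kappa> (oper (tuple_alg M n) f xss)" for f xss
  proof -
    have "oper M f (map (\<lambda>x. x s) (map ?\<kappa> xss)) = oper (tuple_alg M n) f xss ! inv_into {..<n} g s"
      if "s \<in> ?S" for s
    proof -
      have "inv_into {..<n} g s < n"
        using inv_into_into[OF that] by simp
      moreover have "map (\<lambda>x. x s) (map ?\<kappa> xss) = map (\<lambda>a. a ! inv_into {..<n} g s) xss"
        using that by simp
      ultimately show ?thesis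
        by (simp only: nth_oper_tuple_alg)
    qed
    then show ?thesis
      unfolding pow_alg_def by (auto intro!: restrict_ext simp del: map_map)
  qed
  have \<kappa>_pow: "?\<kappa> a \<in> ?S \<rightarrow>\<^sub>E univ M" if "a \<in> r" for a
    using that compatible_relD(2)[OF r] inv_into_into[of _ g "{..<n}"]
    by (fastforce simp: tuples_def)
  have sub: "subuniverse Sg (pow_alg M ?S) (?\<kappa> ` r)"
    unfolding subuniverse_def closed_under_def
  proof (intro conjI allI impI)
    show "?\<kappa> ` r \<noteq> {}"
      using compatible_relD(1)[OF r] by simp
    show "?\<kappa> ` r \<subseteq> univ (pow_alg M ?S)"
      unfolding pow_alg_def ualg.simps by (rule image_subsetI) (rule \<kappa>_pow)
    fix f k as assume f: "Sg f = Some k" and as: "as \<in> tuples k (?\<kappa> ` r)"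
    then obtain xss where xss: "set xss \<subseteq> r" "as = map ?\<kappa> xss"
      using set_subset_imageE[of as ?\<kappa> r] by (auto simp: tuples_def)
    then have "oper (tuple_alg M n) f xss \<in> r"
      using compatible_relD(3)[OF r f, of xss] as by (auto simp: tuples_def)
    then show "oper (pow_alg M ?S) f as \<in> ?\<kappa> ` r"
      unfolding xss(2) \<kappa>_oper by (rule imageI)
  qed
  have "inj_on ?\<kappa> r"
  proof (rule inj_onI)
    fix a b assume ab: "a \<in> r" "b \<in> r" and eq: "?\<kappa> a = ?\<kappa> b"
    show "a = b"
    proof (rule nth_equalityI)
      show len: "length a = length b"
        using ab compatible_relD(2)[OF r] by (auto simp: tuples_def)
      fix i assume "i < length a"
      then have "i < n"
        using ab compatible_relD(2)[OF r] by (auto simp: tuples_def)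
      then show "a ! i = b ! i"
        using \<kappa>[of i a] \<kappa>[of i b] fun_cong[OF eq, of "g i"] by simp
    qed
  qed
  then have "bij_betw (\<lambda>x\<in>e ` r. ?\<kappa> (?e' x)) (e ` r) (?\<kappa> ` r)"
    unfolding bij_betw_def inj_on_def using e' by (auto simp: image_iff)
  moreover have "(\<lambda>x\<in>e ` r. ?\<kappa> (?e' x)) \<in> alg_hom Sg ?A (subalg (pow_alg M ?S) (?\<kappa> ` r))"
  proof (rule alg_homI)
    let ?\<phi> = "\<lambda>x\<in>e ` r. ?\<kappa> (?e' x)"
    show "?\<phi> x \<in> univ (subalg (pow_alg M ?S) (?\<kappa> ` r))" if "x \<in> univ ?A" for x
      using that e' by auto
    fix f k as assume f: "Sg f = Some k" "length as = k" "set as \<subseteq> univ ?A"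
    then obtain xss where xss: "set xss \<subseteq> r" "as = map e xss"
      using set_subset_imageE[of as e r] by auto
    have "oper (tuple_alg M n) f xss \<in> r"
      using compatible_relD(3)[OF r f(1), of xss] xss f(2) by simp
    moreover have "map ?\<phi> as = map ?\<kappa> xss"
    proof -
      have "?\<phi> (e a) = ?\<kappa> a" if "a \<in> r" for a
        using that e' by simp
      then show ?thesis
        unfolding xss(2) map_map
        by (intro map_cong refl) (simp only: comp_apply subsetD[OF xss(1)])
    qed
    ultimately show "?\<phi> (oper ?A f as) = oper (subalg (pow_alg M ?S) (?\<kappa> ` r)) f (map ?\<phi> as)"
      using oper_A[OF xss(1), of f] xss(2) \<kappa>_oper[of f xss] e' by (simp del: map_map map_eq_conv)
  qed simp
  ultimately have "(\<lambda>x\<in>e ` r. ?\<kappa> (?e' x)) \<in> alg_iso Sg ?A (subalg (pow_alg M ?S) (?\<kappa> ` r))"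
    unfolding alg_iso_def univ_subalg ualg.simps by blast
  then have "?A \<in> ISP TYPE('u) Sg M"
    unfolding ISP_def using alg_A sub by blast
  moreover have "finite (univ ?A)" "bij_betw e r (univ ?A)"
    using finite_compatible_rel[OF r] e by (simp_all add: bij_betw_def)
  ultimately show ?thesis
    using oper_A by blast
qed

text \<open>The index set already lies in \<open>'u\<close>, so only the points, which are functions
  on \<open>S\<close>, are renamed. The copy gets the discrete topology, which is also that of the
  finite Hausdorff original.\<close>

lemma ex_copy_in_IScP:
  fixes S :: "'u set"
  assumes universe: "infinite (UNIV :: 'u set)" and S: "S \<noteq> {}"
    and closed: "pop_closed H (pow_tstr (ego M) S) B" and fin: "finite B"
  shows "\<exists>(X :: ('a, 'u) tstr) \<phi>. X \<in> IScP TYPE('u) M H R \<and> finite (pts X) \<and>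
    \<phi> \<in> tstr_iso H R X (induced (pow_tstr (ego M) S) B)"
proof -
  let ?Y = "induced (pow_tstr (ego M) S) B"
  note ptsY = pop_closed_pts_induced[OF closed]
  obtain g :: "('u \<Rightarrow> 'a) \<Rightarrow> 'u" where g: "inj_on g B"
    using ex_inj_on_infinite_type[OF fin universe] by blast
  let ?g' = "inv_into B g"
  define X :: "('a, 'u) tstr" where "X =
    \<lparr>topo = discrete_topology (g ` B),
     pops = (\<lambda>h xs. if set xs \<subseteq> g ` B then map_option g (pops ?Y h (map ?g' xs)) else None),
     rels = (\<lambda>r. {xs. set xs \<subseteq> g ` B \<and> map ?g' xs \<in> rels ?Y r})\<rparr>"
  have ptsX: "pts X = g ` B"
    by (simp add: X_def)
  have discX: "topo X = discrete_topology (g ` B)"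
    by (simp add: X_def)
  have popsX: "pops X h xs = Some y \<longleftrightarrow> set xs \<subseteq> g ` B \<and> (\<exists>z. pops ?Y h (map ?g' xs) = Some z \<and> y = g z)"
    for h xs y
    by (auto simp: X_def)
  have relsX: "xs \<in> rels X r \<longleftrightarrow> set xs \<subseteq> g ` B \<and> map ?g' xs \<in> rels ?Y r" for r xs
    by (simp add: X_def)
  have discY: "topo ?Y = discrete_topology B"
    using finite_Hausdorff_imp_discrete[OF _ Hausdorff_induced_pow_ego, of M S B] fin by (simp only: ptsY)
  note wfY = wf_induced_pow[OF S closed]
  have inY: "set xs \<subseteq> B \<and> y \<in> B" if "h \<in> H" "pops ?Y h xs = Some y" for h xs y
    using wfY that ptsY unfolding wf_tstr_def by blast
  have g'g: "?g' (g b) = b" if "b \<in> B" for b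
    by (rule inv_into_f_f[OF g that])
  have map_g'g: "map ?g' (map g xs) = xs" if "set xs \<subseteq> B" for xs
    unfolding map_map using that g'g by (intro map_idI) (simp only: comp_apply subsetD)
  let ?\<phi> = "\<lambda>x\<in>g ` B. ?g' x" and ?\<psi> = "\<lambda>b\<in>B. g b"
  have map_\<phi>: "map ?\<phi> xs = map ?g' xs" if "set xs \<subseteq> g ` B" for xs
    using that by auto
  have map_\<psi>: "map ?\<psi> xs = map g xs" if "set xs \<subseteq> B" for xs
    using that by auto
  have \<phi>: "?\<phi> \<in> morph H R X ?Y"
  proof (rule morphI)
    show "?\<phi> \<in> extensional (pts X)"
      by (simp add: ptsX)
    show "?\<phi> x \<in> pts ?Y" if "x \<in> pts X" for x
      using that g'g unfolding ptsX ptsY by auto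
    show "continuous_map (topo X) (topo ?Y) ?\<phi>"
      using g'g ptsY by (intro continuous_map_of_discrete[OF discX]) auto
    show "pops ?Y h (map ?\<phi> xs) = Some (?\<phi> y)" if h: "h \<in> H" and y: "pops X h xs = Some y" for h xs y
    proof -
      obtain z where z: "set xs \<subseteq> g ` B" "pops ?Y h (map ?g' xs) = Some z" "y = g z"
        using y popsX by blast
      then have "z \<in> B"
        using inY[OF h] by blast
      then show ?thesis
        using z g'g by (simp add: map_\<phi>[OF z(1)])
    qed
    show "map ?\<phi> xs \<in> rels ?Y r" if "r \<in> R" "xs \<in> rels X r" for r xs
      using that(2) map_\<phi>[of xs] unfolding relsX by (simp only:)
  qed
  have \<psi>: "?\<psi> \<in> morph H R ?Y X"
  proof (rule morphI)
    show "?\<psi> \<in> extensional (pts ?Y)"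
      unfolding ptsY by simp
    show "?\<psi> b \<in> pts X" if "b \<in> pts ?Y" for b
      using that unfolding ptsX ptsY by simp
    show "continuous_map (topo ?Y) (topo X) ?\<psi>"
      by (intro continuous_map_of_discrete[OF discY]) (simp add: ptsX)
    show "pops X h (map ?\<psi> xs) = Some (?\<psi> y)" if "h \<in> H" "pops ?Y h xs = Some y" for h xs y
    proof -
      have xs: "set xs \<subseteq> B" and y: "y \<in> B"
        using inY that by blast+
      then have "set (map g xs) \<subseteq> g ` B"
        by auto
      then show ?thesis
        unfolding popsX map_\<psi>[OF xs] map_g'g[OF xs] using that(2) y by simp
    qed
    show "map ?\<psi> xs \<in> rels X r" if "r \<in> R" "xs \<in> rels ?Y r" for r xs
    proof -
      have xs: "set xs \<subseteq> B"
        using that(2) unfolding rels_induced_pow by blast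
      then have "set (map g xs) \<subseteq> g ` B"
        by auto
      then show ?thesis
        unfolding relsX map_\<psi>[OF xs] map_g'g[OF xs] using that(2) by simp
    qed
  qed
  have "\<forall>x\<in>pts X. ?\<psi> (?\<phi> x) = x" "\<forall>b\<in>pts ?Y. ?\<phi> (?\<psi> b) = b"
    unfolding ptsX ptsY using g'g by simp_all
  then have iso: "?\<phi> \<in> tstr_iso H R X ?Y"
    unfolding tstr_iso_def using \<phi> \<psi> by blast
  have "set xs \<subseteq> g ` B \<and> y \<in> g ` B \<and> (\<forall>as\<in>dom h. length as = length xs)"
    if h: "h \<in> H" and y: "pops X h xs = Some y" for h xs y
  proof -
    obtain z where z: "set xs \<subseteq> g ` B" "pops ?Y h (map ?g' xs) = Some z" "y = g z"
      using y popsX by blast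
    have "\<forall>as\<in>dom h. length as = length (map ?g' xs)"
      using wfY h z(2) unfolding wf_tstr_def by blast
    then show ?thesis
      using inY[OF h z(2)] z(1,3) by simp
  qed
  moreover have "set xs \<subseteq> g ` B \<and> (\<forall>as\<in>r. length as = length xs)"
    if r: "r \<in> R" and xs: "xs \<in> rels X r" for r xs
  proof -
    have xs': "set xs \<subseteq> g ` B" "map ?g' xs \<in> rels ?Y r"
      using xs relsX by blast+
    then have "\<forall>as\<in>r. length as = length (map ?g' xs)"
      using wfY r unfolding wf_tstr_def by blast
    then show ?thesis
      using xs'(1) by simp
  qed
  ultimately have wf: "wf_tstr H R X"
    unfolding wf_tstr_def ptsX by blast
  have "closedin (topo (pow_tstr (ego M) S)) B"
  proof -
    have "B \<subseteq> pts (pow_tstr (ego M) S)"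
      using closed unfolding pop_closed_def by blast
    then show ?thesis
      using Hausdorff_imp_t1_space[OF Hausdorff_pow_ego] fin t1_space_closedin_finite by blast
  qed
  then have "X \<in> IScP TYPE('u) M H R"
    unfolding IScP_def using wf S closed iso by blast
  then show ?thesis
    using iso fin ptsX by auto
qed

text \<open>By hom-minimality each point of D(A) is a coordinate of \<open>r\<close>. A tuple
  \<open>v\<close> thus gives a map on D(A), which is a morphism if \<open>v\<close> satisfies all
  atoms valid on \<open>r\<close>; surjectivity of \<eta> then produces a member of \<open>r\<close>
  equal to \<open>v\<close>.\<close>

lemma hom_minimal_in_Rel_ca:
  assumes universe: "infinite (UNIV :: 'u set)"
    and dual: "fully_dualises_finite_level TYPE('u) Sg M H R" and hm: "hom_minimal Sg M r"
  shows "r \<in> Rel_ca (univ M) H R"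
proof -
  obtain n where r: "compatible_rel Sg M n r" and proj: "\<And>\<phi>. \<phi> \<in> alg_hom Sg (subalg (tuple_alg M n) r) M \<Longrightarrow>
      \<exists>i<n. \<forall>xs\<in>r. \<phi> xs = xs ! i"
    using hm unfolding hom_minimal_def by blast
  obtain A :: "('f, 'u) ualg" and e where A: "A \<in> ISP TYPE('u) Sg M" "finite (univ A)" "bij_betw e r (univ A)"
    and oper_A: "\<And>f k xss. Sg f = Some k \<Longrightarrow> length xss = k \<Longrightarrow> set xss \<subseteq> r \<Longrightarrow>
      oper A f (map e xss) = e (oper (tuple_alg M n) f xss)"
    using ex_copy_in_ISP[OF universe r] by blast
  have e_r: "e ` r = univ A" and e_inj: "inj_on e r"
    using A(3) by (auto simp: bij_betw_def)
  have alg_A: "ualgebra Sg A"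
    using A(1) unfolding ISP_def by blast
  let ?X = "dual_D Sg M A" and ?r = "subalg (tuple_alg M n) r"
  have "eta Sg M A \<in> alg_iso Sg A (dual_E M H R ?X)"
    using dual A(1,2) unfolding fully_dualises_finite_level_def by blast
  then have eta_surj: "eta Sg M A ` univ A = morph H R ?X (ego M)"
    unfolding alg_iso_def bij_betw_def by simp
  have "\<exists>i. i < n \<and> (\<forall>a\<in>r. x (e a) = a ! i)" if x: "x \<in> alg_hom Sg A M" for x
  proof -
    have "(\<lambda>a\<in>r. x (e a)) \<in> alg_hom Sg ?r M"
    proof (rule alg_homI)
      show "(\<lambda>a\<in>r. x (e a)) a \<in> univ M" if "a \<in> univ ?r" for a
        using alg_homD(1)[OF x, of "e a"] e_r that by auto
      fix f k xss assume *: "Sg f = Some k" "length xss = k" "set xss \<subseteq> univ ?r"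
      then have xss: "set xss \<subseteq> r" "set (map e xss) \<subseteq> univ A"
        using e_r by auto
      have "x (e (oper (tuple_alg M n) f xss)) = oper M f (map x (map e xss))"
        using alg_homD(3)[OF x *(1) _ xss(2)] *(2) oper_A[OF *(1,2) xss(1)] by simp
      moreover have "map x (map e xss) = map (\<lambda>a\<in>r. x (e a)) xss"
        using xss by auto
      ultimately show "(\<lambda>a\<in>r. x (e a)) (oper ?r f xss) = oper M f (map (\<lambda>a\<in>r. x (e a)) xss)"
        using compatible_relD(3)[OF r *(1,2) xss(1)] by (simp del: map_map map_eq_conv)
    qed simp
    then show ?thesis
      using proj[of "\<lambda>a\<in>r. x (e a)"] by auto
  qed
  then have "\<exists>idx. \<forall>x\<in>alg_hom Sg A M. idx x < n \<and> (\<forall>a\<in>r. x (e a) = a ! idx x)"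
    by (intro bchoice) blast
  then obtain idx where idx: "\<And>x. x \<in> alg_hom Sg A M \<Longrightarrow> idx x < n \<and> (\<forall>a\<in>r. x (e a) = a ! idx x)"
    by blast
  have ne: "univ A \<noteq> {}"
    using alg_A unfolding ualgebra_def by blast
  have wf: "wf_tstr H R ?X"
    unfolding dual_D_def by (rule wf_induced_pow[OF ne alg_hom_pop_closed[OF alg_A]])
  have map_idx: "map ((!) a) (map idx xs) = map (\<lambda>x. x (e a)) xs"
    if "a \<in> r" "set xs \<subseteq> alg_hom Sg A M" for a xs
    using that idx by auto
  have "v \<in> r" if v: "v \<in> tuples n (univ M)"
    and atoms: "\<And>\<alpha>. wf_atomic H R n \<alpha> \<Longrightarrow> \<forall>xs\<in>r. holds xs \<alpha> \<Longrightarrow> holds v \<alpha>" for v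
  proof -
    let ?u = "\<lambda>x\<in>pts ?X. v ! idx x"
    have map_u: "map ?u xs = map ((!) v) (map idx xs)" if "set xs \<subseteq> alg_hom Sg A M" for xs
      using that by auto
    have "?u \<in> morph H R ?X (ego M)"
    proof (rule morphI)
      show u: "?u x \<in> pts (ego M)" if "x \<in> pts ?X" for x
        using that v idx[of x] by (auto simp: tuples_def)
      have "topo ?X = discrete_topology (pts ?X)"
        unfolding dual_D_def
        by (rule finite_Hausdorff_imp_discrete[OF _ Hausdorff_induced_pow_ego])
          (simp add: finite_alg_hom[OF A(2) finite_M])
      then show "continuous_map (topo ?X) (topo (ego M)) ?u"
        using u by (rule continuous_map_of_discrete)
      show "pops (ego M) h (map ?u xs) = Some (?u y)" if h: "h \<in> H" and y: "pops ?X h xs = Some y" for h xs y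
      proof -
        have xy: "set xs \<subseteq> alg_hom Sg A M" "y \<in> alg_hom Sg A M" "\<forall>as\<in>dom h. length as = length xs"
          using wf h y unfolding wf_tstr_def pts_dual_D by blast+
        \<comment> \<open>The value \<open>y\<close> is again a homomorphism, hence a coordinate, so
          this instance of \<open>h\<close> in D(A) becomes an equation between coordinates of
          \<open>r\<close>.\<close>
        let ?\<alpha> = "EqAtom (App h (map Var (map idx xs))) (Var (idx y))"
        have "wf_atomic H R n ?\<alpha>"
          using h xy idx by (auto simp: list_all_iff)
        moreover have "holds a ?\<alpha>" if a: "a \<in> r" for a
        proof -
          have "e a \<in> univ A"
            using a e_r by blast
          then have "h (map (\<lambda>x. x (e a)) xs) = Some (y (e a))"
            using y unfolding dual_D_def pops_induced_pow_eq_Some by blast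
          then show ?thesis
            unfolding holds.simps eval_App_map_Var map_idx[OF a xy(1)] using idx[OF xy(2)] a by simp
        qed
        ultimately have "holds v ?\<alpha>"
          using atoms by blast
        then show ?thesis
          unfolding holds.simps eval_App_map_Var map_u[OF xy(1)] using xy(2) by simp
      qed
      show "map ?u xs \<in> rels (ego M) \<rho>" if \<rho>: "\<rho> \<in> R" and xs: "xs \<in> rels ?X \<rho>" for \<rho> xs
      proof -
        have xs': "set xs \<subseteq> alg_hom Sg A M" "\<forall>as\<in>\<rho>. length as = length xs"
          using wf \<rho> xs unfolding wf_tstr_def pts_dual_D by blast+
        let ?\<alpha> = "RelAtom \<rho> (map Var (map idx xs))"
        have "wf_atomic H R n ?\<alpha>"
          using \<rho> xs' idx by (auto simp: list_all_iff)
        moreover have "holds a ?\<alpha>" if a: "a \<in> r" for a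
        proof -
          have "e a \<in> univ A"
            using a e_r by blast
          then have "map (\<lambda>x. x (e a)) xs \<in> \<rho>"
            using xs unfolding dual_D_def rels_induced_pow by blast
          then show ?thesis
            unfolding holds_RelAtom_map_Var map_idx[OF a xs'(1)] .
        qed
        ultimately have "holds v ?\<alpha>"
          using atoms by blast
        then show ?thesis
          unfolding holds_RelAtom_map_Var map_u[OF xs'(1)] by simp
      qed
    qed simp
    then have "?u \<in> eta Sg M A ` e ` r"
      unfolding eta_surj e_r .
    then obtain a where a: "a \<in> r" "?u = eta Sg M A (e a)"
      by blast
    have len: "length v = n" "length a = n"
      using v a(1) compatible_relD(2)[OF r] by (auto simp: tuples_def)
    have "v ! i = a ! i" if i: "i < n" for i
    proof -
      have "\<exists>x\<in>alg_hom Sg A M. \<forall>b\<in>r. x (e b) = b ! i"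
      proof
        let ?x = "\<lambda>c\<in>univ A. inv_into r e c ! i"
        have inv: "inv_into r e (e b) = b" if "b \<in> r" for b
          by (rule inv_into_f_f[OF e_inj that])
        have x: "?x (e b) = b ! i" if "b \<in> r" for b
          using that e_r inv by auto
        then show "\<forall>b\<in>r. ?x (e b) = b ! i"
          by blast
        show "?x \<in> alg_hom Sg A M"
        proof (rule alg_homI)
          show "?x c \<in> univ M" if c: "c \<in> univ A" for c
          proof -
            obtain b where b: "b \<in> r" "c = e b"
              using c unfolding e_r[symmetric] by blast
            then show ?thesis
              using subsetD[OF compatible_relD(2)[OF r] b(1)] x[OF b(1)] i by (auto simp: tuples_def)
          qed
          fix f k as assume *: "Sg f = Some k" "length as = k" "set as \<subseteq> univ A"
          obtain xss where xss: "set xss \<subseteq> r" "as = map e xss"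
            using set_subset_imageE[of as e r] *(3) unfolding e_r by blast
          have "oper (tuple_alg M n) f xss \<in> r"
            using compatible_relD(3)[OF r *(1) _ xss(1)] xss(2) *(2) by simp
          then have "?x (oper A f as) = oper (tuple_alg M n) f xss ! i"
            using oper_A[OF *(1) _ xss(1)] *(2) xss(2) x by simp
          also have "\<dots> = oper M f (map (\<lambda>b. b ! i) xss)"
            by (rule nth_oper_tuple_alg[OF i])
          also have "map (\<lambda>b. b ! i) xss = map ?x as"
            unfolding xss(2) map_map
            by (intro map_cong refl) (simp only: comp_apply x subsetD[OF xss(1)])
          finally show "?x (oper A f as) = oper M f (map ?x as)" .
        qed simp
      qed
      then obtain x where x: "x \<in> alg_hom Sg A M" "\<forall>b\<in>r. x (e b) = b ! i"
        by blast
      \<comment> \<open>If coordinates of \<open>r\<close> coincide, \<open>idx\<close> may choose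
        an index other than \<open>i\<close> for the \<open>i\<close>-th projection. The coincidence
        is itself a valid atom, so \<open>v\<close> shares it.\<close>
      let ?\<alpha> = "EqAtom (Var (idx x)) (Var i)"
      have "wf_atomic H R n ?\<alpha>" "\<forall>b\<in>r. holds b ?\<alpha>"
        using i idx[OF x(1)] x(2) by auto
      then have "holds v ?\<alpha>"
        using atoms by blast
      then have "v ! i = ?u x"
        using x(1) by simp
      also have "\<dots> = x (e a)"
        unfolding a(2) using x(1) a(1) e_r by (auto simp: eta_def)
      finally show ?thesis
        using x(2) a(1) by simp
    qed
    then have "v = a"
      using len by (auto intro: nth_equalityI)
    then show ?thesis
      using a(1) by simp
  qed
  then have "\<exists>\<Phi>. list_all (wf_atomic H R n) \<Phi> \<and> r = ca_defined (univ M) n \<Phi>"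
    by (intro ca_definedI[OF finite_M compatible_relD(2)[OF r]]) blast
  then show ?thesis
    using compatible_relD(1)[OF r] unfolding Rel_ca_def by blast
qed

text \<open>Evaluating \<open>h\<close> at the \<open>n\<close> points that stand for the
  projections gives a homomorphism on E(X). Fullness makes it evaluation at a point of
  \<open>X\<close>, and the term representing this point extends \<open>h\<close>.\<close>

lemma op_rich_at_Rel_ca:
  assumes universe: "infinite (UNIV :: 'u set)"
    and dual: "fully_dualises_finite_level TYPE('u) Sg M H R" and r: "r \<in> Rel_ca (univ M) H R"
  shows "op_rich_at Sg M H r"
proof (rule op_rich_atI)
  fix n h assume h: "compatible_pop Sg M n h" and dom_h: "dom h = r"
  obtain m \<Phi> where \<Phi>: "list_all (wf_atomic H R m) \<Phi>" "r = ca_defined (univ M) m \<Phi>" and r_ne: "r \<noteq> {}"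
    using r unfolding Rel_ca_def by blast
  have r_n: "r \<subseteq> tuples n (univ M)"
    using compatible_popD(2)[OF h] dom_h by simp
  have "r \<subseteq> tuples m (univ M)"
    unfolding \<Phi>(2) ca_defined_def by blast
  then have m: "m = n"
    using tuples_arity_unique[OF r_ne _ r_n] by blast
  have "finite r"
    using finite_subset[OF r_n finite_tuples[OF finite_M]] .
  then obtain e :: "'a list \<Rightarrow> 'u" where e: "inj_on e r"
    using ex_inj_on_infinite_type[OF _ universe] by blast
  have e': "inv_into r e (e a) = a" if "a \<in> r" for a
    by (rule inv_into_f_f[OF e that])
  let ?S = "e ` r"
  \<comment> \<open>The substructure generated by the projections in the power with exponent
    \<open>r\<close>: the term functions defined on all of \<open>r\<close>.\<close>
  define B where "B = {b \<in> ?S \<rightarrow>\<^sub>E univ M. \<exists>t. wf_pterm H n t \<and> (\<forall>a\<in>r. eval_pterm a t = Some (b (e a)))}"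
  have closed: "pop_closed H (pow_tstr (ego M) ?S) B"
    unfolding pop_closed_def
  proof (intro conjI ballI allI impI)
    show "B \<subseteq> pts (pow_tstr (ego M) ?S)"
      by (auto simp: B_def)
    fix g xs y assume g: "g \<in> H" and xs: "set xs \<subseteq> B" and "pops (pow_tstr (ego M) ?S) g xs = Some y"
    then have "pops (induced (pow_tstr (ego M) ?S) B) g xs = Some y"
      by (simp add: induced_def)
    then have y: "y \<in> extensional ?S" "\<And>a. a \<in> r \<Longrightarrow> g (map (\<lambda>x. x (e a)) xs) = Some (y (e a))"
      unfolding pops_induced_pow_eq_Some by auto
    obtain k where k: "compatible_pop Sg M k g"
      using H_compatible[OF g] by blast
    have "\<exists>t. wf_pterm H n t \<and> (\<forall>a\<in>r. eval_pterm a t = Some (x (e a)))" if "x \<in> set xs" for x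
      using xs that unfolding B_def by blast
    then obtain ts where ts: "length ts = length xs"
      "\<And>i. i < length xs \<Longrightarrow> wf_pterm H n (ts ! i) \<and> (\<forall>a\<in>r. eval_pterm a (ts ! i) = Some ((xs ! i) (e a)))"
      using ex_map_of_list_all[of xs "\<lambda>x t. wf_pterm H n t \<and> (\<forall>a\<in>r. eval_pterm a t = Some (x (e a)))"] by blast
    obtain a where "a \<in> r"
      using r_ne by blast
    then have "map (\<lambda>x. x (e a)) xs \<in> tuples k (univ M)"
      using y(2) compatible_popD(2)[OF k] by blast
    then have "\<forall>as\<in>dom g. length as = length ts"
      using compatible_popD(2)[OF k] ts(1) by (auto simp: tuples_def)
    then have "wf_pterm H n (App g ts)"
      using g ts by (simp add: list_all_length)
    moreover have "eval_pterm a (App g ts) = Some (y (e a))" if a: "a \<in> r" for a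
    proof -
      have "map (eval_pterm a) ts = map Some (map (\<lambda>x. x (e a)) xs)"
        using ts a by (intro nth_equalityI) auto
      then show ?thesis
        using y(2)[OF a] unfolding eval_App_eq_Some by blast
    qed
    moreover have "y \<in> ?S \<rightarrow>\<^sub>E univ M"
      using y compatible_popD(3)[OF k] by (intro PiE_I) (auto simp: extensional_def)
    ultimately show "y \<in> B"
      unfolding B_def by blast
  qed
  have "finite (?S \<rightarrow>\<^sub>E univ M)"
    using \<open>finite r\<close> finite_M by (intro finite_PiE) auto
  then have "finite B"
    by (rule rev_finite_subset) (auto simp: B_def)
  moreover have S_ne: "?S \<noteq> {}"
    using r_ne by simp
  ultimately obtain X :: "('a, 'u) tstr" and \<phi> where X: "X \<in> IScP TYPE('u) M H R" "finite (pts X)"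
    and \<phi>: "\<phi> \<in> tstr_iso H R X (induced (pow_tstr (ego M) ?S) B)"
    using ex_copy_in_IScP[OF universe _ closed] by blast
  have wf: "wf_tstr H R X"
    using X(1) unfolding IScP_def by blast
  let ?Mor = "morph H R X (ego M)"
  note sep = coordinates_separate[OF S_ne closed \<phi> wf]
  note ptsY = pop_closed_pts_induced[OF closed]
  obtain \<psi> where \<phi>m: "\<phi> \<in> morph H R X (induced (pow_tstr (ego M) ?S) B)"
    and \<psi>m: "\<psi> \<in> morph H R (induced (pow_tstr (ego M) ?S) B) X" and \<phi>\<psi>: "\<And>b. b \<in> B \<Longrightarrow> \<phi> (\<psi> b) = b"
    using \<phi> unfolding tstr_iso_def ptsY by blast
  have disc: "topo X = discrete_topology (pts X)"
    by (rule discrete_of_tstr_iso[OF \<phi> X(2)])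
  let ?\<pi> = "\<lambda>i. \<lambda>s\<in>?S. inv_into r e s ! i"
  have \<pi>: "?\<pi> i \<in> B" if i: "i < n" for i
  proof -
    have "?\<pi> i \<in> ?S \<rightarrow>\<^sub>E univ M"
      using r_n i e' by (fastforce simp: tuples_def)
    moreover have "wf_pterm H n (Var i)" "\<forall>a\<in>r. eval_pterm a (Var i) = Some (?\<pi> i (e a))"
      using i e' by simp_all
    ultimately show ?thesis
      unfolding B_def by blast
  qed
  let ?xs = "map (\<lambda>i. \<psi> (?\<pi> i)) [0..<n]"
  have xsX: "set ?xs \<subseteq> pts X"
    using morphD(2)[OF \<psi>m, unfolded ptsY, OF \<pi>] by auto
  have coord: "map (\<lambda>x\<in>pts X. \<phi> x (e a)) ?xs = a" if a: "a \<in> r" for a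
  proof (rule nth_equalityI)
    show "length (map (\<lambda>x\<in>pts X. \<phi> x (e a)) ?xs) = length a"
      using r_n a by (auto simp: tuples_def)
    fix i assume "i < length (map (\<lambda>x\<in>pts X. \<phi> x (e a)) ?xs)"
    then have i: "i < n"
      by simp
    have "\<psi> (?\<pi> i) \<in> pts X"
      using morphD(2)[OF \<psi>m, unfolded ptsY, OF \<pi>[OF i]] .
    then show "map (\<lambda>x\<in>pts X. \<phi> x (e a)) ?xs ! i = a ! i"
      using i \<phi>\<psi>[OF \<pi>[OF i]] a e'[OF a] by simp
  qed
  \<comment> \<open>Here definability of \<open>r\<close> enters. The coordinate at \<open>a\<close>
    sends the points \<open>?xs\<close> to \<open>a\<close>, so the defining formula holds in all
    coordinates and hence under \<open>u\<close>. Thus \<open>h\<close> is defined at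
    \<open>map u ?xs\<close>.\<close>
  have in_r: "map u ?xs \<in> r" if u: "u \<in> ?Mor" for u
  proof -
    have "holds (map u ?xs) \<alpha>" if \<alpha>: "\<alpha> \<in> set \<Phi>" for \<alpha>
    proof (rule holds_in_structure[OF sep _ xsX _ u])
      show "wf_atomic H R (length ?xs) \<alpha>"
        using \<Phi>(1) \<alpha> m by (simp add: list_all_iff)
      fix p assume "p \<in> coordinates X ?S \<phi>"
      then obtain a where a: "a \<in> r" "p = (\<lambda>x\<in>pts X. \<phi> x (e a))"
        unfolding coordinates_def by blast
      have "holds a \<alpha>"
        using a(1) \<alpha> unfolding \<Phi>(2) ca_defined_def by blast
      then show "holds (map p ?xs) \<alpha>"
        unfolding a(2) coord[OF a(1)] .
    qed
    moreover have "map u ?xs \<in> tuples m (univ M)"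
      using morphD(2)[OF u] xsX m by (auto simp: tuples_def)
    ultimately show ?thesis
      unfolding \<Phi>(2) ca_defined_def by blast
  qed
  let ?E = "dual_E M H R X"
  let ?h = "\<lambda>u\<in>?Mor. the (h (map u ?xs))"
  have "?h \<in> alg_hom Sg ?E M"
  proof (rule alg_homI)
    show "?h u \<in> univ M" if "u \<in> univ ?E" for u
      using that in_r[of u] compatible_popD(3)[OF h] dom_h by auto
    fix f k us assume *: "Sg f = Some k" "length us = k" "set us \<subseteq> univ ?E"
    then have v: "oper ?E f us \<in> ?Mor"
      using dual_E_closed[OF wf disc _ *(1,2)] by simp
    have "set (map (\<lambda>u. map u ?xs) us) \<subseteq> dom h"
      using * in_r dom_h by auto
    then have "h (oper (tuple_alg M n) f (map (\<lambda>u. map u ?xs) us)) =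
        Some (oper M f (map (\<lambda>ys. the (h ys)) (map (\<lambda>u. map u ?xs) us)))"
      using * by (intro compatible_popD(4)[OF h]) auto
    moreover have "oper (tuple_alg M n) f (map (\<lambda>u. map u ?xs) us) = map (oper ?E f us) ?xs"
      using oper_tuple_alg_rows[OF xsX, of M f us] unfolding oper_dual_E by simp
    moreover have "map (\<lambda>ys. the (h ys)) (map (\<lambda>u. map u ?xs) us) = map ?h us"
      using * by auto
    ultimately show "?h (oper ?E f us) = oper M f (map ?h us)"
      using v by (simp del: map_map map_eq_conv)
  qed simp
  moreover have "eps M H R X \<in> tstr_iso H R X (dual_D Sg M ?E)"
    using dual X unfolding fully_dualises_finite_level_def by blast
  then have "\<forall>y\<in>alg_hom Sg ?E M. \<exists>x\<in>pts X. eps M H R X x = y"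
    unfolding tstr_iso_def using morphD(2)[of _ H R "dual_D Sg M ?E" X] by auto
  ultimately obtain x where x: "x \<in> pts X" "eps M H R X x = ?h"
    by blast
  have hx: "the (h (map u ?xs)) = u x" if "u \<in> ?Mor" for u
    using fun_cong[OF x(2), of u] x(1) that by (simp add: eps_def)
  have "\<phi> x \<in> B"
    using morphD(2)[OF \<phi>m x(1)] unfolding ptsY .
  then obtain t where t: "wf_pterm H n t" "\<forall>a\<in>r. eval_pterm a t = Some (\<phi> x (e a))"
    unfolding B_def by blast
  \<comment> \<open>Take for \<open>u\<close> the coordinate at \<open>a\<close>: the left side of
    \<open>hx\<close> becomes \<open>h a\<close>, and the right side is the value at
    \<open>a\<close> of the term function represented by \<open>x\<close>.\<close>
  have "eval_pterm a t = h a" if a: "a \<in> r" for a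
  proof -
    have "(\<lambda>x\<in>pts X. \<phi> x (e a)) \<in> ?Mor"
      using separatesD(2)[OF sep] a unfolding coordinates_def by blast
    then have "the (h a) = \<phi> x (e a)"
      using hx coord[OF a] x(1) by fastforce
    then show ?thesis
      using t(2) a dom_h by force
  qed
  then show "\<exists>t. wf_pterm H n t \<and> (\<forall>xs\<in>r. eval_pterm xs t = h xs)"
    using t(1) by blast
qed

text \<open>This is (3) implies (1). For \<epsilon>, richness is needed at the relation of rows of
  \<open>X\<close>, and \<open>morphisms_ca_definable\<close> places this relation among those
  covered by (3)(c).\<close>

lemma fully_dualisesI:
  assumes hm: "\<And>r. hom_minimal Sg M r \<Longrightarrow> r \<in> Rel_ca (univ M) H R"
    and rich: "\<And>\<rho>. \<rho> \<in> R \<union> {dom h | h. h \<in> H} \<Longrightarrow> op_rich_at Sg M H \<rho>"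
    and rich_hm: "\<And>r. r \<in> ca_definable_from_hom_minimal Sg M \<Longrightarrow> op_rich_at Sg M H r"
  shows "fully_dualises_finite_level TYPE('u) Sg M H R"
  unfolding fully_dualises_finite_level_def
proof (intro conjI allI impI; elim conjE)
  show "eta Sg M A \<in> alg_iso Sg A (dual_E M H R (dual_D Sg M A))"
    if "A \<in> ISP TYPE('u) Sg M" "finite (univ A)" for A :: "('f, 'u) ualg"
    using hm that by (rule eta_iso)
next
  fix X :: "('a, 'u) tstr"
  assume X: "X \<in> IScP TYPE('u) M H R" and fin: "finite (pts X)"
  obtain S :: "'u set" and B \<phi> where S: "S \<noteq> {}" and closed: "pop_closed H (pow_tstr (ego M) S) B"
    and \<phi>: "\<phi> \<in> tstr_iso H R X (induced (pow_tstr (ego M) S) B)" and wf: "wf_tstr H R X"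
    using X unfolding IScP_def by blast
  note sep = coordinates_separate[OF S closed \<phi> wf]
  note disc = discrete_of_tstr_iso[OF \<phi> fin]
  obtain xs where xs: "set xs = pts X" "distinct xs"
    using finite_distinct_list[OF fin] by blast
  have "op_rich_at Sg M H ((\<lambda>u. map u xs) ` morph H R X (ego M))"
    by (rule rich_hm[OF morphisms_ca_definable[OF sep wf disc xs rich]])
  then have "\<exists>x\<in>pts X. \<forall>u\<in>morph H R X (ego M). \<psi> u = u x"
    if "\<psi> \<in> alg_hom Sg (dual_E M H R X) M" for \<psi>
    using hom_dual_E_is_evaluation[OF sep wf disc xs(1) _ that] by blast
  then show "eps M H R X \<in> tstr_iso H R X (dual_D Sg M (dual_E M H R X))"
    by (rule eps_iso[OF sep wf disc fin])
qed

end

theorem theorem8p5: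
  fixes Sg :: "'f sg" and M :: "('f, 'a) ualg"
    and H :: "'a pop set" and R :: "'a lrel set"
  assumes universe: "infinite (UNIV :: 'u set)"
    and algebra: "ualgebra Sg M" and finite: "finite (univ M)"
    and ego: "alter_ego Sg M H R"
  shows
    "(fully_dualises_finite_level TYPE('u) Sg M H R
      \<longleftrightarrow> (\<forall>r. hom_minimal Sg M r \<longrightarrow> r \<in> Rel_ca (univ M) H R)
        \<and> (\<forall>r \<in> Rel_ca (univ M) H R. op_rich_at Sg M H r))
   \<and> (fully_dualises_finite_level TYPE('u) Sg M H R
      \<longleftrightarrow> (\<forall>r. hom_minimal Sg M r \<longrightarrow> r \<in> Rel_ca (univ M) H R)
        \<and> (\<forall>r \<in> R \<union> {dom h | h. h \<in> H}. op_rich_at Sg M H r)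
        \<and> (\<forall>r \<in> ca_definable_from_hom_minimal Sg M. op_rich_at Sg M H r))"
    (is "(?one \<longleftrightarrow> ?a \<and> ?b) \<and> (?one \<longleftrightarrow> ?a \<and> ?b' \<and> ?c)")
proof -
  interpret finite_alter_ego Sg M H R
    by unfold_locales (rule algebra finite ego)+
  \<comment> \<open>The conditions are linked in the cycle from (1) to (2) to (3) and back to
    (1).\<close>
  have "?a \<and> ?b" if ?one
    using hom_minimal_in_Rel_ca[OF universe that] op_rich_at_Rel_ca[OF universe that] by blast
  moreover have "?b'" if ?b
  proof -
    have "r \<in> Rel_ca (univ M) H R" if "r \<in> R" for r
      using R_compatible[OF that] mem_Rel_caI[OF that] compatible_relD(1,2) by metis
    moreover have "dom h \<in> Rel_ca (univ M) H R" if "h \<in> H" for h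
      using H_compatible[OF that] dom_mem_Rel_caI[OF that] compatible_popD(1,2) by metis
    ultimately show ?thesis
      using that by blast
  qed
  moreover have "?c" if ?a ?b
    using Rel_ca_mono_of_relations[OF finite_M, of "{r. hom_minimal Sg M r}" H R] that
    unfolding ca_definable_from_hom_minimal_def by blast
  moreover have "?one" if ?a "?b'" ?c
    using that by (intro fully_dualisesI) blast+
  ultimately show ?thesis
    by blast
qed

end
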